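(* Let $D$ be a non-empty fourling shape and let $h$, $v$, $s$ be nonnegative integers. Then $$\sum_{\lambda} I_\lambda = 0,$$ where the sum is taken over all partition shapes $\lambda$ with fourling body $\mathrm{fb}(\lambda)=D$, exactly $s$ squares in the strip of $\lambda$, $\mathrm{hs}(\lambda)=h$ and $\mathrm{vs}(\lambda)=v$.
   Context: A shape $\lambda=(\lambda_1,\lambda_2,\ldots)$ is the Ferrers diagram of an integer partition; square $(r,c)$ is in row $r$ (counted from the top) and column $c$ (counted from the left); $\lambda\vdash n$ means $\lambda$ has $n$ squares. A standard Young tableau (SYT) on an $n$-shape is a filling of its squares with $1,\ldots,n$, each used once, increasing along rows (left to right) and down columns. The sign $\mathrm{sgn}(T)$ of a tableau is the sign of the word obtained by reading its entries row by row, left to right, top to bottom (like a book), where the sign of a word $w_1\cdots w_k$ of distinct integers is $(-1)^{|\{(i,j):i<j,\ w_i>w_j\}|}$. The sign-imbalance is $I_\lambda=\sum_{T\in\mathrm{SYT}(\lambda)}\mathrm{sgn}(T)$. A domino is a $1\times 2$ or $2\times1$ rectangle of two squares; a fourling is a $2\times 2$ square. A fourling shape is a (possibly empty) shape that is a union of fourlings, i.e. a shape $\mu$ with $\mu_{2i-1}=\mu_{2i}$ even for all $i$. The fourling body $\mathrm{fb}(\lambda)$ is the largest fourling shape contained in $\lambda$; the squares of $\lambda$ not in $\mathrm{fb}(\lambda)$ form the strip of $\lambda$. $\mathrm{vs}(\lambda)$ is the maximal number of disjoint vertical dominoes that fit in the strip of $\lambda$, and $\mathrm{hs}(\lambda)=\mathrm{vs}(\lambda')$,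 where $\lambda'$ is the conjugate (transpose) shape. *)

theory Defs
  imports Main "HOL-Library.FuncSet"
begin

text \<open>Squares are pairs \<open>(r, c)\<close> of a row and a column, both counted from 1.\<close>

type_synonym square = "nat \<times> nat"

definition is_partition :: "nat list \<Rightarrow> bool" where
  "is_partition lam \<longleftrightarrow> sorted_wrt (\<ge>) lam \<and> 0 \<notin> set lam"

definition ferrers :: "nat list \<Rightarrow> square set" where
  "ferrers lam = {(r, c). 1 \<le> r \<and> r \<le> length lam \<and> 1 \<le> c \<and> c \<le> lam ! (r - 1)}"

definition is_shape :: "square set \<Rightarrow> bool" where
  "is_shape S \<longleftrightarrow> (\<exists>lam. is_partition lam \<and> S = ferrers lam)"

text \<open>For a shape \<open>S\<close>, \<open>part S r\<close> is the \<open>r\<close>-th part of its partition (0 if there is none).\<close>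

definition part :: "square set \<Rightarrow> nat \<Rightarrow> nat" where
  "part S r = card {c. (r, c) \<in> S}"

definition conjugate :: "square set \<Rightarrow> square set" where
  "conjugate S = {(r, c). (c, r) \<in> S}"

text \<open>A filling is \<open>undefined\<close> outside the shape, so that distinct functions are distinct fillings.\<close>

definition SYT :: "square set \<Rightarrow> (square \<Rightarrow> nat) set" where
  "SYT S = {T \<in> extensional S. bij_betw T S {1..card S} \<and>
     (\<forall>r c c'. (r, c) \<in> S \<longrightarrow> (r, c') \<in> S \<longrightarrow> c < c' \<longrightarrow> T (r, c) < T (r, c')) \<and>
     (\<forall>r r' c. (r, c) \<in> S \<longrightarrow> (r', c) \<in> S \<longrightarrow> r < r' \<longrightarrow> T (r, c) < T (r', c))}"

definition word_sign :: "nat list \<Rightarrow> int" where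
  "word_sign w = (- 1) ^ card {(i, j). i < j \<and> j < length w \<and> w ! i > w ! j}"

definition reading_word :: "square set \<Rightarrow> (square \<Rightarrow> nat) \<Rightarrow> nat list" where
  "reading_word S T =
     concat (map (\<lambda>r. map (\<lambda>c. T (r, c)) [1..<Suc (part S r)]) [1..<Suc (card (fst ` S))])"

definition sgn_tableau :: "square set \<Rightarrow> (square \<Rightarrow> nat) \<Rightarrow> int" where
  "sgn_tableau S T = word_sign (reading_word S T)"

definition sign_imbalance :: "square set \<Rightarrow> int" where
  "sign_imbalance S = (\<Sum>T\<in>SYT S. sgn_tableau S T)"

definition fourling_shape :: "square set \<Rightarrow> bool" where
  "fourling_shape S \<longleftrightarrow> is_shape S \<and>
     (\<forall>i\<ge>1. part S (2 * i - 1) = part S (2 * i) \<and> even (part S (2 * i)))"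

text \<open>\<open>GREATEST\<close> refers to the inclusion order on sets of squares; the maximum exists by
  \<open>fb_greatest\<close> below.\<close>

definition fb :: "square set \<Rightarrow> square set" where
  "fb S = (GREATEST M. fourling_shape M \<and> M \<subseteq> S)"

definition strip :: "square set \<Rightarrow> square set" where
  "strip S = S - fb S"

definition vertical_domino :: "square set \<Rightarrow> bool" where
  "vertical_domino d \<longleftrightarrow> (\<exists>r c. d = {(r, c), (Suc r, c)})"

definition vs :: "square set \<Rightarrow> nat" where
  "vs S = Max {card F | F. (\<forall>d\<in>F. vertical_domino d \<and> d \<subseteq> strip S) \<and> pairwise disjnt F}"

definition hs :: "square set \<Rightarrow> nat" where
  "hs S = vs (conjugate S)"

lemma initial_segment:
  fixes A :: "nat set"
  assumes fin: "finite A" and ge1: "\<And>a. a \<in> A \<Longrightarrow> 1 \<le> a"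
    and down: "\<And>a b. a \<in> A \<Longrightarrow> 1 \<le> b \<Longrightarrow> b \<le> a \<Longrightarrow> b \<in> A"
  shows "A = {1..card A}"
proof (cases "A = {}")
  case False
  have "A = {1..Max A}"
  proof (intro equalityI subsetI)
    fix a assume "a \<in> A"
    then show "a \<in> {1..Max A}" using ge1 Max_ge[OF fin] by simp
  next
    fix b assume "b \<in> {1..Max A}"
    then show "b \<in> A" using down[OF Max_in[OF fin False]] by simp
  qed
  then show ?thesis by (metis card_atLeastAtMost diff_Suc_1)
qed simp

lemma is_shape_iff:
  "is_shape S \<longleftrightarrow> finite S \<and> (\<forall>r c. (r, c) \<in> S \<longrightarrow> 1 \<le> r \<and> 1 \<le> c) \<and>
     (\<forall>r c r' c'. (r, c) \<in> S \<longrightarrow> 1 \<le> r' \<longrightarrow> r' \<le> r \<longrightarrow> 1 \<le> c' \<longrightarrow> c' \<le> c \<longrightarrow> (r', c') \<in> S)"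
  (is "?L \<longleftrightarrow> ?R")
proof
  assume ?L
  then obtain lam where lam: "is_partition lam" "S = ferrers lam"
    by (auto simp: is_shape_def)
  have "S \<subseteq> {..length lam} \<times> {..sum_list lam}"
    using lam(2) by (auto simp: ferrers_def intro: order_trans[OF _ elem_le_sum_list])
  then have "finite S" by (rule finite_subset) auto
  moreover have "lam ! (r - 1) \<le> lam ! (r' - 1)" if "1 \<le> r'" "r' \<le> r" "r \<le> length lam" for r r'
    using lam(1) that sorted_wrt_nth_less[of "(\<ge>)" lam "r' - 1" "r - 1"]
    by (cases "r = r'") (auto simp: is_partition_def)
  then have "(r', c') \<in> S" if "(r, c) \<in> S" "1 \<le> r'" "r' \<le> r" "1 \<le> c'" "c' \<le> c" for r c r' c'
    using that lam(2) by (fastforce simp: ferrers_def)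
  moreover have "1 \<le> r \<and> 1 \<le> c" if "(r, c) \<in> S" for r c
    using that lam(2) by (auto simp: ferrers_def)
  ultimately show ?R by blast
next
  assume R: ?R
  have fin: "finite S"
    and ge1: "\<And>r c. (r, c) \<in> S \<Longrightarrow> 1 \<le> r" "\<And>r c. (r, c) \<in> S \<Longrightarrow> 1 \<le> c"
    and down: "\<And>r c r' c'. (r, c) \<in> S \<Longrightarrow> 1 \<le> r' \<Longrightarrow> r' \<le> r \<Longrightarrow> 1 \<le> c' \<Longrightarrow> c' \<le> c \<Longrightarrow> (r', c') \<in> S"
    using R by blast+
  have row: "{c. (r, c) \<in> S} = {1..part S r}" for r
    unfolding part_def
  proof (rule initial_segment)
    show "finite {c. (r, c) \<in> S}"
      by (rule finite_subset[OF _ finite_imageI[OF fin, of snd]]) force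
  qed (use ge1 down in blast)+
  then have mem: "(r, c) \<in> S \<longleftrightarrow> 1 \<le> c \<and> c \<le> part S r" for r c
    by (metis atLeastAtMost_iff mem_Collect_eq)
  have anti: "part S r \<le> part S r'" if "1 \<le> r'" "r' \<le> r" for r r'
  proof (cases "part S r = 0")
    case False
    then have "(r, part S r) \<in> S" by (simp add: mem)
    then have "(r', part S r) \<in> S" using that False down[of r "part S r" r' "part S r"] by simp
    then show ?thesis by (simp add: mem)
  qed simp
  define n where "n = card {r. (r, 1) \<in> S}"
  have n: "{r. (r, 1) \<in> S} = {1..n}"
    unfolding n_def
  proof (rule initial_segment)
    show "finite {r. (r, 1) \<in> S}"
      by (rule finite_subset[OF _ finite_imageI[OF fin, of fst]]) force
  qed (use ge1 down in blast)+
  have pos: "1 \<le> part S r \<longleftrightarrow> 1 \<le> r \<and> r \<le> n" for r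
    using n mem[of r 1] by (metis atLeastAtMost_iff le_refl mem_Collect_eq)
  define lam where "lam = map (\<lambda>i. part S (Suc i)) [0..<n]"
  have "sorted_wrt (\<ge>) lam"
    by (auto simp: lam_def sorted_wrt_iff_nth_less intro: anti)
  moreover have "part S (Suc i) \<noteq> 0" if "i < n" for i
    using pos[of "Suc i"] that by simp
  then have "0 \<notin> set lam" by (simp add: lam_def image_iff)
  ultimately have "is_partition lam" by (simp add: is_partition_def)
  moreover have "S = ferrers lam"
  proof (intro set_eqI iffI; clarify)
    fix r c assume "(r, c) \<in> S"
    then have "1 \<le> c" "c \<le> part S r" by (auto simp: mem)
    moreover from this have "1 \<le> r \<and> r \<le> n" using pos[of r] by linarith
    ultimately show "(r, c) \<in> ferrers lam" by (auto simp: ferrers_def lam_def)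
  qed (auto simp: ferrers_def lam_def mem)
  ultimately show ?L by (auto simp: is_shape_def)
qed

lemma shape_mem_iff:
  assumes "is_shape S"
  shows "(r, c) \<in> S \<longleftrightarrow> 1 \<le> c \<and> c \<le> part S r"
proof -
  obtain lam where lam: "S = ferrers lam" using assms by (auto simp: is_shape_def)
  show ?thesis
  proof (cases "1 \<le> r \<and> r \<le> length lam")
    case True
    then have "{c. (r, c) \<in> S} = {1..lam ! (r - 1)}" by (auto simp: lam ferrers_def)
    then show ?thesis using True by (auto simp: part_def lam ferrers_def)
  next
    case False
    then have "{c. (r, c) \<in> S} = {}" by (auto simp: lam ferrers_def)
    then show ?thesis by (auto simp: part_def)
  qed
qed

text \<open>A fourling shape is a shape that is a union of fourlings with odd top-left coordinates.\<close>

lemma fourling_shape_iff: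
  "fourling_shape S \<longleftrightarrow> is_shape S \<and>
     (\<forall>r c. (r, c) \<in> S \<longrightarrow> (2 * ((r + 1) div 2), 2 * ((c + 1) div 2)) \<in> S)"
  (is "_ \<longleftrightarrow> _ \<and> ?B")
proof (cases "is_shape S")
  case True
  note mem = shape_mem_iff[OF True]
  have down: "\<And>r c r' c'. (r, c) \<in> S \<Longrightarrow> 1 \<le> r' \<Longrightarrow> r' \<le> r \<Longrightarrow> 1 \<le> c' \<Longrightarrow> c' \<le> c \<Longrightarrow> (r', c') \<in> S"
    and ge1: "\<And>r c. (r, c) \<in> S \<Longrightarrow> 1 \<le> r \<and> 1 \<le> c"
    using True unfolding is_shape_iff by blast+
  have "?B" if F: "\<forall>i\<ge>1. part S (2 * i - 1) = part S (2 * i) \<and> even (part S (2 * i))"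
  proof (intro allI impI)
    fix r c assume rc: "(r, c) \<in> S"
    define i where "i = (r + 1) div 2"
    have "1 \<le> i" "r = 2 * i - 1 \<or> r = 2 * i" using ge1[OF rc] by (auto simp: i_def)
    then have "part S r = part S (2 * i)" "even (part S (2 * i))" using F by auto
    moreover from this have "2 * ((c + 1) div 2) \<le> part S (2 * i)"
      using rc by (auto simp: mem elim!: evenE)
    ultimately show "(2 * ((r + 1) div 2), 2 * ((c + 1) div 2)) \<in> S"
      using ge1[OF rc] by (auto simp: mem i_def)
  qed
  moreover have "part S (2 * i - 1) = part S (2 * i) \<and> even (part S (2 * i))"
    if B: ?B and i: "1 \<le> i" for i
  proof
    let ?p = "part S (2 * i - 1)" and ?q = "part S (2 * i)"
    have "?q \<le> ?p"
    proof (cases "?q = 0")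
      case False
      then have "(2 * i - 1, ?q) \<in> S"
        using down[of "2 * i" ?q "2 * i - 1" ?q] i by (auto simp: mem)
      then show ?thesis by (simp add: mem)
    qed simp
    moreover have "?p \<le> ?q"
    proof (cases "?p = 0")
      case False
      then have "(2 * i - 1, ?p) \<in> S" by (auto simp: mem)
      with B have "(2 * ((2 * i - 1 + 1) div 2), 2 * ((?p + 1) div 2)) \<in> S" by blast
      then show ?thesis using i by (auto simp: mem)
    qed simp
    ultimately show "?p = ?q" by simp
    show "even ?q"
    proof (cases "?q = 0")
      case False
      then have "(2 * i, ?q) \<in> S" by (auto simp: mem)
      with B have "(2 * ((2 * i + 1) div 2), 2 * ((?q + 1) div 2)) \<in> S" by blast
      then have "2 * ((?q + 1) div 2) \<le> ?q" by (auto simp: mem)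
      then show ?thesis by presburger
    qed simp
  qed
  ultimately show ?thesis using True unfolding fourling_shape_def by blast
qed (simp add: fourling_shape_def)

lemma fb_greatest:
  assumes "is_shape S"
  shows "fourling_shape (fb S)" "fb S \<subseteq> S"
    and "\<And>M. fourling_shape M \<Longrightarrow> M \<subseteq> S \<Longrightarrow> M \<subseteq> fb S"
proof -
  let ?U = "\<Union>{M. fourling_shape M \<and> M \<subseteq> S}"
  have "finite ?U"
    by (rule finite_subset[of _ S]) (use assms in \<open>auto simp: is_shape_iff\<close>)
  moreover have "1 \<le> r \<and> 1 \<le> c" if "(r, c) \<in> ?U" for r c
    using that assms unfolding is_shape_iff by blast
  moreover have "(r', c') \<in> ?U"
    if rc: "(r, c) \<in> ?U" and le: "1 \<le> r'" "r' \<le> r" "1 \<le> c'" "c' \<le> c" for r c r' c'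
  proof -
    obtain M where M: "fourling_shape M" "M \<subseteq> S" "(r, c) \<in> M" using rc by blast
    then have "is_shape M" by (simp add: fourling_shape_def)
    then have "(r', c') \<in> M" using M(3) le unfolding is_shape_iff by blast
    with M show ?thesis by blast
  qed
  ultimately have "is_shape ?U" unfolding is_shape_iff by blast
  moreover have "(2 * ((r + 1) div 2), 2 * ((c + 1) div 2)) \<in> ?U" if rc: "(r, c) \<in> ?U" for r c
  proof -
    obtain M where M: "fourling_shape M" "M \<subseteq> S" "(r, c) \<in> M" using rc by blast
    then have "(2 * ((r + 1) div 2), 2 * ((c + 1) div 2)) \<in> M"
      unfolding fourling_shape_iff by blast
    with M(1,2) show ?thesis by blast
  qed
  ultimately have "fourling_shape ?U" unfolding fourling_shape_iff by blast
  then have U: "fourling_shape ?U" "?U \<subseteq> S" by blast+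
  have "fb S = ?U" unfolding fb_def by (rule Greatest_equality) (use U in blast)+
  with U show "fourling_shape (fb S)" "fb S \<subseteq> S" by simp_all
  show "M \<subseteq> fb S" if "fourling_shape M" "M \<subseteq> S" for M
    unfolding \<open>fb S = ?U\<close> using that by blast
qed

lemma finite_shapes: "finite {S. is_shape S \<and> fb S = D \<and> card (strip S) = s}"
proof (rule finite_subset)
  let ?n = "card D + s"
  show "{S. is_shape S \<and> fb S = D \<and> card (strip S) = s} \<subseteq> Pow ({..?n} \<times> {..?n})"
  proof (clarify)
    fix S r c assume S: "is_shape S" "s = card (strip S)" "D = fb S" "(r, c) \<in> S"
    have fin: "finite S" using S(1) is_shape_iff by blast
    then have card: "card S = card (fb S) + card (strip S)"
      using fb_greatest(2)[OF S(1)] by (simp add: strip_def card_Diff_subset finite_subset card_mono)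
    have ge: "1 \<le> r" "1 \<le> c"
      and down: "\<And>r' c'. 1 \<le> r' \<Longrightarrow> r' \<le> r \<Longrightarrow> 1 \<le> c' \<Longrightarrow> c' \<le> c \<Longrightarrow> (r', c') \<in> S"
      using S(1,4) unfolding is_shape_iff by blast+
    have "(\<lambda>i. (i, c)) ` {1..r} \<subseteq> S" "(\<lambda>j. (r, j)) ` {1..c} \<subseteq> S"
      using ge by (auto intro: down)
    then have "card ((\<lambda>i. (i, c)) ` {1..r}) \<le> card S" "card ((\<lambda>j. (r, j)) ` {1..c}) \<le> card S"
      using fin by (auto intro: card_mono)
    then show "r \<in> {..card (fb S) + card (strip S)} \<and> c \<in> {..card (fb S) + card (strip S)}"
      using card by (simp add: card_image inj_on_def)
  qed
qed auto

end

theory Submission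
  imports Defs Complex_Main
begin

text \<open>
  A shape in a large square box is the word of the steps of its boundary, read from the north-east
  to the south-west; removing a corner exchanges two adjacent letters. Removing the largest entry
  of a tableau shows that the vector of sign-imbalances is obtained by iterating a signed
  corner-removal operator. Signed sums over horizontal strips, over vertical strips, and over
  removals of black corners (squares of odd content) commute with this operator up to a sign and a
  scalar, so each of them maps the vector of sign-imbalances to a multiple of itself. Since a
  non-empty fourling shape has sign-imbalance 0, the sum over all ways to add to it a horizontal
  strip (weight \<open>X\<close> per square) and then a vertical strip vanishes on that vector. On
  shapes whose imbalance is nonzero the number of white squares exceeds the number of black ones
  by 0 or 1. Comparing letter by letter, the strip sum is there a nonzero multiple of the black
  corner sum composed with the weight \<open>(- X\<^sup>2) ^ hs\<close> on the shapes with the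
  given fourling body. Hence these weighted sums of sign-imbalances vanish for all
  \<open>X\<close>, and so does each coefficient. Finally \<open>hs + vs\<close> is the number
  of black squares of the strip, which is half its size, rounded down.
\<close>

section \<open>Boundary words and strip kernels\<close>

text \<open>Signs rule out plain commutation with corner removal: one more square in the outer word
  flips the sign of every strip square before it. What survives links corner addition on the outer
  word with corner removal on the inner one, up to the relative sign of the two sizes and a multiple
  of the kernel. That multiple may depend on the relative sign. For black corners it vanishes at
  even size differences, so their signed sum fixes the vector of sign-imbalances. The kernels read
  both words with a finite state; each identity becomes a check of the first two letters, at the
  price of statements about suffixes. In a union of a horizontal and a vertical strip only the
  north-eastern square of each component can lie in either, whence a factor \<open>X + r\<close>
  with \<open>r\<close> equal to 1 or -1. Its sign depends on the squares already met, so the strip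
  sum is no direct multiple of a weight in \<open>hs\<close>. But components opened by a white
  square and those closed by a black one shift the colour excess in opposite directions, and the
  discrepancies telescope to a function of that excess, which is constant where imbalances of one
  size are nonzero.\<close>

text \<open>
  A boundary word is read from the north-east to the south-west; \<open>False\<close> is a
  horizontal and \<open>True\<close> a vertical step. A vertical step ends a row whose length is
  the number of horizontal steps after it.
\<close>

primrec horiz :: "bool list \<Rightarrow> nat" where
  "horiz [] = 0" | "horiz (b # l) = (if b then horiz l else Suc (horiz l))"

primrec area :: "bool list \<Rightarrow> nat" where
  "area [] = 0" | "area (b # l) = (if b then horiz l else 0) + area l"

definition area_sign :: "bool list \<Rightarrow> real" where "area_sign l = (-1) ^ area l"

definition horiz_sign :: "bool list \<Rightarrow> real" where "horiz_sign l = (-1) ^ horiz l"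

lemma area_sign_simps [simp]: "area_sign [] = 1" "area_sign (True # l) =
    horiz_sign l * area_sign l" "area_sign (False # l) = area_sign l"
  by (simp_all add: area_sign_def horiz_sign_def power_add)

lemma horiz_sign_simps [simp]: "horiz_sign [] = 1" "horiz_sign (True # l) =
    horiz_sign l" "horiz_sign (False # l) = - horiz_sign l"
  by (simp_all add: horiz_sign_def)

lemma horiz_sign_cases: "horiz_sign l = 1 \<or> horiz_sign l = -1"
    by (simp add: horiz_sign_def minus_one_power_iff)

lemma area_sign_sq: "area_sign l * area_sign l = 1" "area_sign l * (area_sign l * z) = z"
  by (simp_all add: area_sign_def flip: power_add mult.assoc)

lemma horiz_sign_sq: "horiz_sign l * horiz_sign l = 1" "horiz_sign l * (horiz_sign l * z) = z"
  by (simp_all add: horiz_sign_def flip: power_add mult.assoc)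

text \<open>
  A corner is a factor \<open>True, False\<close>, and the squares following it in the reading
  order are those of the word after it, whence the sign.
\<close>

fun corner_sum :: "(bool list \<Rightarrow> real) \<Rightarrow> bool list \<Rightarrow> real" where
  "corner_sum f (x # y # s) = (if x \<and> \<not> y then
      area_sign s * f (False # True # s) else 0) + corner_sum (\<lambda>t. f (x # t)) (y # s)"
| "corner_sum f _ = 0"

fun corner_sum_adj :: "(bool list \<Rightarrow> real) \<Rightarrow> bool list \<Rightarrow> real"
    where
  "corner_sum_adj f (x # y # s) = (if \<not> x \<and> y then
      area_sign s * f (True # False # s) else 0) + corner_sum_adj (\<lambda>t. f (x # t)) (y # s)"
| "corner_sum_adj f _ = 0"

lemma corner_sum_cmult: "corner_sum (\<lambda>t. c * f t) l = c * corner_sum f l"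
  by (induction f l rule: corner_sum.induct) (auto simp: algebra_simps)

lemma corner_sum_adj_cmult: "corner_sum_adj (\<lambda>t. c * f t) l = c * corner_sum_adj f l"
  by (induction f l rule: corner_sum_adj.induct) (auto simp: algebra_simps)

lemma corner_sum_0 [simp]: "corner_sum (\<lambda>t. 0) l = 0"
  using corner_sum_cmult[of 0 "\<lambda>_. 0"] by simp

lemma corner_sum_adj_0 [simp]: "corner_sum_adj (\<lambda>t. 0) l = 0"
  using corner_sum_adj_cmult[of 0 "\<lambda>_. 0"] by simp

lemma corner_sum_adj_cong_on: "(\<And>t. horiz t = horiz l \<Longrightarrow>
    area t = Suc (area l) \<Longrightarrow> f t = g t) \<Longrightarrow>
    corner_sum_adj f l = corner_sum_adj g l"
proof (induction f l arbitrary: g rule: corner_sum_adj.induct)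
  case (1 f x y s)
  have "corner_sum_adj (\<lambda>t. f (x # t)) (y # s) =
      corner_sum_adj (\<lambda>t. g (x # t)) (y # s)"
    by (rule 1(1)) (auto intro: 1(2))
  moreover have "f (True # False # s) = g (True # False # s)" if "\<not> x" y
    by (rule 1(2)) (use that in auto)
  ultimately show ?case by simp
qed auto

text \<open>This is \<open>area_sign (True # l)\<close>. For a single corner
  \<open>True # False # s\<close> the strip factor \<open>step_sign (False # s)\<close> is the
  removal sign \<open>area_sign s\<close> times -1 to the power of the column of the square.\<close>

definition step_sign :: "bool list \<Rightarrow> real"
    where "step_sign l = area_sign l * horiz_sign l"

text \<open>Adding a square keeps \<open>horiz\<close> and raises \<open>area\<close> by one. This
  sign change is why the kernels anticommute with the corner operators.\<close>

lemma corner_sum_adj_step_sign: "corner_sum_adj (\<lambda>t. step_sign t * f t) l =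
    - step_sign l * corner_sum_adj f l"
proof -
  have "corner_sum_adj (\<lambda>t. step_sign t * f t) l =
      corner_sum_adj (\<lambda>t. - step_sign l * f t) l"
    by (rule corner_sum_adj_cong_on) (simp add: step_sign_def area_sign_def horiz_sign_def)
  then show ?thesis by (simp only: corner_sum_adj_cmult)
qed

lemma corner_sum_Cons: "corner_sum f (x # l) =
    (if x \<and> l \<noteq> [] \<and> \<not> hd l then
    area_sign (tl l) * f (False # True # tl l) else 0) + corner_sum (\<lambda>t. f (x # t)) l"
  by (cases l) auto

lemma corner_sum_adj_Cons: "corner_sum_adj f (x # l) =
    (if \<not> x \<and> l \<noteq> [] \<and> hd l then
    area_sign (tl l) * f (True # False # tl l) else 0) + corner_sum_adj (\<lambda>t. f (x # t)) l"
  by (cases l) auto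

text \<open>
  In all kernels the first word is the inner shape and the second the outer one. The flag
  \<open>d\<close> tells whether the skew shape has a square on the diagonal reached so far; its
  squares are one per diagonal because a strip contains no \<open>2 \<times> 2\<close> block.
\<close>

context fixes X :: real begin
fun hstrip :: "bool \<Rightarrow> bool list \<Rightarrow> bool list \<Rightarrow> real" where
  "hstrip d [] [] = (if d then 0 else 1)"
| "hstrip False (a # m) (b # l) = (if a =
    b then hstrip False m l else if b then X * (step_sign l * hstrip True m l) else 0)"
| "hstrip True (a # m) (b # l) =
    (if b then 0 else if a then hstrip False m l else X * (step_sign l * hstrip True m l))"
| "hstrip _ _ _ = 0"
end

text \<open>
  For whole boundary words in a large box only the case \<open>\<not> d\<close> with both words
  starting with \<open>False\<close> matters; the other values of the scalar are forced by the
  induction over suffixes.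
\<close>

lemma hstrip_comm:
  assumes "length m = length l" "m \<noteq> []" "last m" "last l" "horiz_sign m =
      (if d then - horiz_sign l else horiz_sign l)"
  shows "corner_sum_adj (hstrip X d m) l +
      (if d then - horiz_sign l else 1) * area_sign l * area_sign m * corner_sum (\<lambda>t.
      hstrip X d t l) m =
    (if \<not> d \<and> \<not> hd m \<and> \<not> hd l then - area_sign l * area_sign m * X
     else X * (horiz_sign m - (if d then
         - horiz_sign l else 1) * area_sign l * area_sign m)) * hstrip X d m l"
  using assms
proof (induction m arbitrary: l d)
  case Nil then show ?case by simp
next
  case (Cons a m)
  then obtain b l' where l: "l = b # l'" by (cases l) auto
  show ?case
  proof (cases m)
    case Nil
    then show ?thesis using Cons.prems l by (cases d) (auto simp: step_sign_def)
  next
    case m: (Cons a2 m2)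
    then obtain b2 l2 where l': "l' = b2 # l2" using Cons.prems l by (cases l') auto
    \<comment> \<open>The digit is the flag after the first letter; \<open>A\<close> stands for
      additions to the outer suffix, \<open>U\<close> for removals from the inner one.\<close>
    define A0 A1 U0 U1 where AU: "A0 = corner_sum_adj (hstrip X False m) l'" "A1 =
        corner_sum_adj (hstrip X True m) l'"
      "U0 = corner_sum (\<lambda>t. hstrip X False t l') m" "U1 =
          corner_sum (\<lambda>t. hstrip X True t l') m"
    have pre: "length m = length l'" "m \<noteq> []" "last m" "last l'" and hm: "hd m =
        a2" "hd l' = b2"
      using Cons.prems l l' m by auto
    have IH0': "A0 + area_sign l' * area_sign m * U0 =
        (if \<not> a2 \<and> \<not> b2 then - area_sign l' * area_sign m * X
     else X * (horiz_sign m - area_sign l' * area_sign m)) * hstrip X False m l'"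
         if "horiz_sign m = horiz_sign l'"
      using Cons.IH[OF pre, of False] that
          by (simp only: AU hm if_False not_False_eq_True simp_thms mult_1)
    have IH1': "A1 + - horiz_sign l' * area_sign l' * area_sign m * U1 =
        X * (horiz_sign m - - horiz_sign l' * area_sign l' * area_sign m) * hstrip X True m l'"
        if "horiz_sign m = - horiz_sign l'"
      using Cons.IH[OF pre, of True] that by (simp only: AU hm if_True if_False simp_thms)
    \<comment> \<open>Solving for the addition terms makes the hypotheses usable as rewrite rules in
      the case analysis.\<close>
    have IH0: "A0 = (if \<not> a2 \<and> \<not> b2 then - area_sign l' * area_sign m * X
     else X * (horiz_sign m - area_sign l' * area_sign m)) * hstrip X False m l' - area_sign l' *
         area_sign m * U0" if "horiz_sign m = horiz_sign l'"
      using IH0'[OF that] by linarith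
    have IH1: "A1 = X * (horiz_sign m - - horiz_sign l' * area_sign l' * area_sign m) *
        hstrip X True m l' - - horiz_sign l' * area_sign l' * area_sign m * U1"
        if "horiz_sign m = - horiz_sign l'"
      using IH1'[OF that] by linarith
    \<comment> \<open>Only the corner formed by the first two letters is split off; all other
      corners lie in the suffix and are met in the state reached after the first letter.\<close>
    have tU: "corner_sum (\<lambda>t. hstrip X d t l) (a # m) =
        (if a \<and> \<not> a2 then area_sign m2 * hstrip X d (False # True # m2) l else 0) +
       (if \<not> d then (if a = b then U0 else if b then
           X * (step_sign l' * U1) else 0) else (if b then 0 else if a then
           U0 else X * (step_sign l' * U1)))"
      unfolding AU l by (cases d; cases a; cases b; simp add: corner_sum_Cons[of _ _ m]
          corner_sum_cmult) (simp_all add: m)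
    have tA: "corner_sum_adj (hstrip X d (a # m)) l =
        (if \<not> b \<and> b2 then area_sign l2 * hstrip X d (a # m) (True # False # l2) else 0) +
       (if \<not> d then (if a = b then A0 else if b then
           - X * (step_sign l' * A1) else 0) else (if b then 0 else if a then
           A0 else - X * (step_sign l' * A1)))"
      unfolding AU l by (cases d; cases a; cases b; simp add: corner_sum_adj_Cons[of _ _ l']
          corner_sum_adj_cmult corner_sum_adj_step_sign) (simp_all add: l')
    have c: "horiz_sign (a # m) = (if d then - horiz_sign l else horiz_sign l)"
        using Cons.prems by simp
    have sq: "area_sign m2 * area_sign m2 = 1" "area_sign l2 * area_sign l2 =
        1" "horiz_sign l2 * horiz_sign l2 = 1" "horiz_sign l2 \<noteq> 0"
      using area_sign_sq horiz_sign_sq horiz_sign_cases[of l2] by auto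
    \<comment> \<open>What remains is a finite check over the flag and the first two letters of both
      words, where all signs square to 1.\<close>
    show ?thesis unfolding tU tA
      using c IH0 IH1 unfolding l l' m
      apply (cases d; cases a; cases b; cases a2; cases b2; simp add: step_sign_def sq(4))
      apply (simp_all add: algebra_simps area_sign_sq horiz_sign_sq)
      done
  qed
qed

text \<open>Each square turns \<open>r\<close> into \<open>- r\<close>, so \<open>k\<close> squares
  carry an extra sign with exponent \<open>k (k - 1) / 2\<close>. This matches the sign change in
  \<open>step_sign_vstrip\<close>, so that squares of both kinds of strip advance the composed
  kernel in the same way.\<close>

fun vstrip :: "bool \<Rightarrow> real \<Rightarrow> bool list \<Rightarrow> bool list
    \<Rightarrow> real" where
  "vstrip d r [] [] = (if d then 0 else 1)"
| "vstrip False r (a # m) (b # l) = (if a =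
    b then vstrip False r m l else if b then r * (step_sign l * vstrip True (- r) m l) else 0)"
| "vstrip True r (a # m) (b # l) =
    (if \<not> a then 0 else if b then r * (step_sign l * vstrip True (- r) m l) else
    vstrip False r m l)"
| "vstrip _ _ _ _ = 0"

text \<open>Every remaining strip square contributes one factor \<open>r\<close> up to sign, and the
  prefactor is the parity of their number. The correction for \<open>d\<close> arises because the
  outer word has already closed a row that is still open in the inner word.\<close>

lemma vstrip_neg:
  assumes "length m = length l" "horiz_sign m = (if d then - horiz_sign l else horiz_sign l)"
  shows "vstrip d (- r) m l = (if d then
      - horiz_sign l else 1) * area_sign l * area_sign m * vstrip d r m l"
  using assms
proof (induction d r m l rule: vstrip.induct)
  case (2 r a m b l)
  then show ?case by (cases a; cases b) (auto simp: algebra_simps area_sign_sq horiz_sign_sq)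
next
  case (3 r a m b l)
  then show ?case by (cases a; cases b) (auto simp: algebra_simps area_sign_sq horiz_sign_sq)
qed auto

text \<open>The induction is that of \<open>hstrip_comm\<close>. Whole words have \<open>d\<close>
  unset and begin with \<open>False\<close>, so their scalar is the constant \<open>- r\<close>; the
  other value occurs at proper suffixes.\<close>

lemma vstrip_comm:
  assumes "length m = length l" "m \<noteq> []" "last m" "last l" "horiz_sign m =
      (if d then - horiz_sign l else horiz_sign l)"
  shows "corner_sum_adj (vstrip d r m) l +
      (if d then - horiz_sign l else 1) * area_sign l * area_sign m * corner_sum (\<lambda>t.
      vstrip d r t l) m =
    (if \<not> d \<and> hd m then - r * (1 - horiz_sign m * area_sign l * area_sign m) else
        - r) * vstrip d r m l"
  using assms
proof (induction m arbitrary: l d r)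
  case Nil then show ?case by simp
next
  case (Cons a m)
  then obtain b l' where l: "l = b # l'" by (cases l) auto
  show ?case
  proof (cases m)
    case Nil
    then show ?thesis using Cons.prems l by (cases d) (auto simp: step_sign_def)
  next
    case m: (Cons a2 m2)
    then obtain b2 l2 where l': "l' = b2 # l2" using Cons.prems l by (cases l') auto
    define A0 A1 U0 U1 where AU: "A0 = corner_sum_adj (vstrip False r m) l'" "A1 =
        corner_sum_adj (vstrip True (- r) m) l'"
      "U0 = corner_sum (\<lambda>t. vstrip False r t l') m" "U1 =
          corner_sum (\<lambda>t. vstrip True (- r) t l') m"
    have pre: "length m = length l'" "m \<noteq> []" "last m" "last l'" and hm: "hd m =
        a2" "hd l' = b2"
      using Cons.prems l l' m by auto
    have IH0': "A0 + area_sign l' * area_sign m * U0 =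
        (if a2 then - r * (1 - horiz_sign m * area_sign l' * area_sign m) else
        - r) * vstrip False r m l'" if "horiz_sign m = horiz_sign l'"
      using Cons.IH[OF pre, of False r] that
          by (simp only: AU hm if_False not_False_eq_True simp_thms mult_1)
    have IH1': "A1 + - horiz_sign l' * area_sign l' * area_sign m * U1 =
        r * vstrip True (- r) m l'" if "horiz_sign m = - horiz_sign l'"
      using Cons.IH[OF pre, of True "- r"] that
          by (simp only: AU hm if_True if_False simp_thms minus_minus)
    have IH0: "A0 = (if a2 then - r * (1 - horiz_sign m * area_sign l' * area_sign m) else
        - r) * vstrip False r m l' - area_sign l' * area_sign m * U0"
        if "horiz_sign m = horiz_sign l'"
      using IH0'[OF that] by linarith
    have IH1: "A1 = r * vstrip True (- r) m l' - - horiz_sign l' * area_sign l' * area_sign m *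
        U1" if "horiz_sign m = - horiz_sign l'"
      using IH1'[OF that] by linarith
    have tU: "corner_sum (\<lambda>t. vstrip d r t l) (a # m) =
        (if a \<and> \<not> a2 then area_sign m2 * vstrip d r (False # True # m2) l else 0) +
       (if \<not> d then (if a = b then U0 else if b then
           r * (step_sign l' * U1) else 0) else (if \<not> a then 0 else if b then
           r * (step_sign l' * U1) else U0))"
      unfolding AU l by (cases d; cases a; cases b; simp add: corner_sum_Cons[of _ _ m]
          corner_sum_cmult) (simp_all add: m)
    have tA: "corner_sum_adj (vstrip d r (a # m)) l =
        (if \<not> b \<and> b2 then area_sign l2 * vstrip d r (a # m) (True # False # l2) else 0) +
       (if \<not> d then (if a = b then A0 else if b then
           - r * (step_sign l' * A1) else 0) else (if \<not> a then 0 else if b then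
           - r * (step_sign l' * A1) else A0))"
      unfolding AU l by (cases d; cases a; cases b; simp add: corner_sum_adj_Cons[of _ _ l']
          corner_sum_adj_cmult corner_sum_adj_step_sign) (simp_all add: l')
    have c: "horiz_sign (a # m) = (if d then - horiz_sign l else horiz_sign l)"
        using Cons.prems by simp
    have sq: "horiz_sign l2 \<noteq> 0" using horiz_sign_cases[of l2] by auto
    \<comment> \<open>A corner among the first two letters leaves suffix kernels with
      \<open>r\<close> on one side and \<open>- r\<close> on the other; these equations reconcile
      them.\<close>
    have N: "horiz_sign m2 = horiz_sign l2 \<Longrightarrow>
        vstrip False (- r) m2 l2 = area_sign l2 * area_sign m2 * vstrip False r m2 l2"
      "horiz_sign m2 = - horiz_sign l2 \<Longrightarrow>
          vstrip True (- r) m2 l2 = - horiz_sign l2 * area_sign l2 * area_sign m2 *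
          vstrip True r m2 l2"
      using vstrip_neg[of m2 l2 False r] vstrip_neg[of m2 l2 True r] pre m l' by auto
    show ?thesis unfolding tU tA
      using c N IH0 IH1 unfolding l l' m
      apply (cases d; cases a; cases b; cases a2; cases b2; simp add: step_sign_def sq)
      apply (simp_all add: algebra_simps area_sign_sq horiz_sign_sq)
      done
  qed
qed

text \<open>
  The flag \<open>r\<close> is \<open>False\<close> if the next diagonal is black; only black
  corners are removed.
\<close>

context fixes w :: real begin
fun black_kernel :: "bool \<Rightarrow> bool \<Rightarrow> bool list \<Rightarrow> bool list
    \<Rightarrow> real" where
  "black_kernel d r [] [] = (if d then 0 else 1)"
| "black_kernel False r (a # m) (b # l) = (if a =
    b then black_kernel False (\<not> r) m l else if b \<and> \<not> r then
    w * (step_sign l * black_kernel True True m l) else 0)"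
| "black_kernel True r (a # m) (b # l) =
    (if a \<and> \<not> b then black_kernel False False m l else 0)"
| "black_kernel _ _ _ _ = 0"
end

lemma half_eq: "2 * (a + s) = c \<Longrightarrow> a = c / 2 - (s::real)" by simp

text \<open>Whole words have even length, so the parity of the remaining length fixes the colour
  flag. The scalar is half a difference of signs, hence the factor 2. For whole words with an even
  number of horizontal steps it is \<open>w\<close> at odd and 0 at even size differences.\<close>

lemma black_kernel_comm:
  assumes "length m = length l" "even (length m) \<longleftrightarrow>
      \<not> r" "d \<longrightarrow> r" "horiz_sign m =
      (if d then - horiz_sign l else horiz_sign l)"
  shows "2 * (corner_sum_adj (black_kernel w d r m) l +
      (if d then - horiz_sign l else 1) * area_sign l * area_sign m * corner_sum (\<lambda>t.
      black_kernel w d r t l) m) =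
    w * ((if r \<and> \<not> d \<and> \<not> hd m then
        - horiz_sign m else horiz_sign m) - (if d then
        - horiz_sign l else 1) * area_sign l * area_sign m) * black_kernel w d r m l"
  using assms
proof (induction m arbitrary: l d r)
  case Nil then show ?case by simp
next
  case (Cons a m)
  then obtain b l' where l: "l = b # l'" by (cases l) auto
  show ?case
  proof (cases m)
    case Nil
    then have "l' = []" using Cons.prems l by simp
    then show ?thesis using Nil Cons.prems l by (cases d; cases a; cases b; simp)
  next
    case m: (Cons a2 m2)
    then obtain b2 l2 where l': "l' = b2 # l2" using Cons.prems l by (cases l') auto
    define A0 A1 U0 U1 A2 U2 where AU: "A0 =
        corner_sum_adj (black_kernel w False (\<not> r) m) l'" "A1 =
        corner_sum_adj (black_kernel w True True m) l'"
      "U0 = corner_sum (\<lambda>t. black_kernel w False (\<not> r) t l') m" "U1 =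
          corner_sum (\<lambda>t. black_kernel w True True t l') m"
      "A2 = corner_sum_adj (black_kernel w False False m) l'" "U2 =
          corner_sum (\<lambda>t. black_kernel w False False t l') m"
    have pre: "length m = length l'" and hm: "hd m = a2" "hd l' = b2"
      using Cons.prems l l' m by auto
    have IHg: "2 * (corner_sum_adj (black_kernel w d' r' m) l' +
        (if d' then - horiz_sign l' else 1) * area_sign l' * area_sign m * corner_sum (\<lambda>t.
        black_kernel w d' r' t l') m) =
      w * ((if r' \<and> \<not> d' \<and> \<not> a2 then
          - horiz_sign m else horiz_sign m) - (if d' then
          - horiz_sign l' else 1) * area_sign l' * area_sign m) * black_kernel w d' r' m l'"
      if "even (length m) \<longleftrightarrow> \<not> r'" "d' \<longrightarrow> r'" "horiz_sign m
          = (if d' then - horiz_sign l' else horiz_sign l')" for d' r'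
      using Cons.IH[OF pre that] unfolding hm .
    have par: "even (length m) \<longleftrightarrow> r" using Cons.prems(2) by simp
    have IH0': "2 * (A0 + area_sign l' * area_sign m * U0) =
        w * ((if \<not> r \<and> \<not> a2 then
        - horiz_sign m else horiz_sign m) - area_sign l' * area_sign m) *
        black_kernel w False (\<not> r) m l'" if "horiz_sign m = horiz_sign l'"
      using IHg[of "\<not> r" False] par that
          by (simp only: AU if_False not_False_eq_True simp_thms mult_1)
    have IH1': "2 * (A1 + - horiz_sign l' * area_sign l' * area_sign m * U1) =
        w * (horiz_sign m - - horiz_sign l' * area_sign l' * area_sign m) *
        black_kernel w True True m l'" if "horiz_sign m = - horiz_sign l'" "\<not> r"
      using IHg[of True True] par that by (simp only: AU if_True if_False simp_thms)
    have IH2': "2 * (A2 + area_sign l' * area_sign m * U2) =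
        w * (horiz_sign m - area_sign l' * area_sign m) * black_kernel w False False m l'"
        if "horiz_sign m = horiz_sign l'" r
      using IHg[of False False] par that by (simp only: AU if_True if_False simp_thms mult_1)
    have IH0: "A0 = w * ((if \<not> r \<and> \<not> a2 then
        - horiz_sign m else horiz_sign m) - area_sign l' * area_sign m) *
        black_kernel w False (\<not> r) m l' / 2 - area_sign l' * area_sign m * U0"
        if "horiz_sign m = horiz_sign l'"
      by (rule half_eq[OF IH0'[OF that]])
    have IH1: "A1 = w * (horiz_sign m - - horiz_sign l' * area_sign l' * area_sign m) *
        black_kernel w True True m l' / 2 - (- horiz_sign l' * area_sign l' * area_sign m *
        U1)" if "horiz_sign m = - horiz_sign l'" "\<not> r"
      by (rule half_eq[OF IH1'[OF that]])
    have IH2: "A2 = w * (horiz_sign m - area_sign l' * area_sign m) *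
        black_kernel w False False m l' / 2 - area_sign l' * area_sign m * U2"
        if "horiz_sign m = horiz_sign l'" r
      by (rule half_eq[OF IH2'[OF that]])
    have tU: "corner_sum (\<lambda>t. black_kernel w d r t l) (a # m) =
        (if a \<and> \<not> a2 then area_sign m2 * black_kernel w d r (False # True # m2) l else
        0) +
       (if \<not> d then (if a = b then U0 else if b \<and> \<not> r then
           w * (step_sign l' * U1) else 0) else (if a \<and> \<not> b then U2 else 0))"
      unfolding AU l by (cases d; cases r; cases a; cases b; simp add: corner_sum_Cons[of _ _ m]
          corner_sum_cmult) (simp_all add: m)
    have tA: "corner_sum_adj (black_kernel w d r (a # m)) l =
        (if \<not> b \<and> b2 then area_sign l2 *
        black_kernel w d r (a # m) (True # False # l2) else 0) +
       (if \<not> d then (if a = b then A0 else if b \<and> \<not> r then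
           - w * (step_sign l' * A1) else 0) else (if a \<and> \<not> b then A2 else 0))"
      unfolding AU l by (cases d; cases r; cases a; cases b; simp add: corner_sum_adj_Cons[of _ _
          l'] corner_sum_adj_cmult corner_sum_adj_step_sign) (simp_all add: l')
    have c: "horiz_sign (a # m) = (if d then - horiz_sign l else horiz_sign l)"
        using Cons.prems by simp
    have sq: "horiz_sign l2 \<noteq> 0" using horiz_sign_cases[of l2] by auto
    have dr: "d \<longrightarrow> r" using Cons.prems by simp
    show ?thesis unfolding tU tA
      using c dr IH0 IH1 IH2 unfolding l l' m
      apply (cases d; cases r; cases a; cases b; cases a2; cases b2; simp add: step_sign_def sq)
      apply (simp_all add: field_simps area_sign_sq horiz_sign_sq)
      done
  qed
qed

section \<open>Action of the kernels on the sign-imbalances\<close>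

primrec word_sum :: "nat \<Rightarrow> (bool list \<Rightarrow> real) \<Rightarrow> real" where
  "word_sum 0 f = f []"
| "word_sum (Suc n) f = word_sum n (\<lambda>l. f (True # l)) +
    word_sum n (\<lambda>l. f (False # l))"

lemma word_sum_eq_sum: "word_sum n f = (\<Sum>l | length l = n. f l)"
proof (induction n arbitrary: f)
  case (Suc n)
  have fin: "finite {l :: bool list. length l = n}"
    using finite_lists_length_eq[of "UNIV :: bool set" n] by simp
  have "{l. length l = Suc n} = Cons True ` {l. length l = n} \<union> Cons False ` {l. length l =
      n}"
    by (auto simp: length_Suc_conv)
  moreover have "Cons True ` {l. length l = n} \<inter> Cons False ` {l. length l = n} = {}" by auto
  ultimately show ?case using fin Suc
    by (simp add: sum.union_disjoint sum.reindex)
qed simp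

lemma word_sum_cong: "(\<And>l. length l = n \<Longrightarrow> f l = g l) \<Longrightarrow>
    word_sum n f = word_sum n g"
  by (simp add: word_sum_eq_sum)

lemma word_sum_add: "word_sum n (\<lambda>l. f l + g l) = word_sum n f + word_sum n g"
  by (simp add: word_sum_eq_sum sum.distrib)

lemma word_sum_cmult: "word_sum n (\<lambda>l. c * f l) = c * word_sum n f"
  by (simp add: word_sum_eq_sum sum_distrib_left)

lemma word_sum_0 [simp]: "word_sum n (\<lambda>l. 0) = 0"
  by (simp add: word_sum_eq_sum)

lemma word_sum_swap: "word_sum n (\<lambda>l. word_sum k (\<lambda>m. f l m)) =
    word_sum k (\<lambda>m. word_sum n (\<lambda>l. f l m))"
  unfolding word_sum_eq_sum by (rule sum.swap)

lemma corner_sum_add: "corner_sum (\<lambda>t. f t + g t) l = corner_sum f l + corner_sum g l"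
proof (induction f l arbitrary: g rule: corner_sum.induct)
  case (1 f x y s)
  show ?case using 1[of "\<lambda>t. g (x # t)"] by (simp add: distrib_left)
qed auto

lemma corner_sum_word_sum: "corner_sum (\<lambda>t. word_sum n (\<lambda>l. f t l)) m =
    word_sum n (\<lambda>l. corner_sum (\<lambda>t. f t l) m)"
  by (induction n arbitrary: f) (simp_all add: corner_sum_add)

lemma corner_sum_cong_on: "(\<And>t. length t = length l \<Longrightarrow>
    horiz t = horiz l \<Longrightarrow> Suc (area t) = area l \<Longrightarrow>
    f t = g t) \<Longrightarrow> corner_sum f l = corner_sum g l"
proof (induction f l arbitrary: g rule: corner_sum.induct)
  case (1 f x y s)
  have "corner_sum (\<lambda>t. f (x # t)) (y # s) = corner_sum (\<lambda>t. g (x # t)) (y # s)"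
    by (rule 1(1)) (auto intro: 1(2))
  moreover have "f (False # True # s) = g (False # True # s)" if x "\<not> y"
    by (rule 1(2)) (use that in auto)
  ultimately show ?case by simp
qed auto

lemma corner_sum_nz: "corner_sum f l \<noteq> 0 \<Longrightarrow>
    \<exists>t. length t = length l \<and> horiz t = horiz l \<and> Suc (area t) =
    area l \<and> f t \<noteq> 0"
  using corner_sum_cong_on[of l f "\<lambda>_. 0"] by auto

text \<open>Removal and addition exchange the same two letters and carry the sign of the same
  suffix, so the operators are transposes of each other.\<close>

lemma corner_sum_adjoint: "word_sum n (\<lambda>l. f l * corner_sum g l) =
    word_sum n (\<lambda>l. corner_sum_adj f l * g l)"
proof (induction n arbitrary: f g)
  case (Suc n)
  have hd: "word_sum n (\<lambda>l. f (True # l) * (if l \<noteq> [] \<and> \<not> hd l then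
      area_sign (tl l) * g (False # True # tl l) else 0)) =
     word_sum n (\<lambda>l. (if l \<noteq> [] \<and> hd l then
         area_sign (tl l) * f (True # False # tl l) else 0) * g (False # l))"
    by (cases n) (simp_all add: algebra_simps)
  have "word_sum (Suc n) (\<lambda>l. f l * corner_sum g l) =
      word_sum n (\<lambda>l. f (True # l) * (if l \<noteq> [] \<and> \<not> hd l then
      area_sign (tl l) * g (False # True # tl l) else 0))
     + word_sum n (\<lambda>l. f (True # l) * corner_sum (\<lambda>t. g (True # t)) l) +
         word_sum n (\<lambda>l. f (False # l) * corner_sum (\<lambda>t. g (False # t)) l)"
    by (simp add: corner_sum_Cons distrib_left word_sum_add)
  also have "\<dots> = word_sum n (\<lambda>l. (if l \<noteq> [] \<and> hd l then
      area_sign (tl l) * f (True # False # tl l) else 0) * g (False # l))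
     + word_sum n (\<lambda>l. corner_sum_adj (\<lambda>t. f (True # t)) l * g (True # l)) +
         word_sum n (\<lambda>l. corner_sum_adj (\<lambda>t. f (False # t)) l * g (False # l))"
    by (simp only: Suc.IH hd)
  also have "\<dots> = word_sum (Suc n) (\<lambda>l. corner_sum_adj f l * g l)"
    by (simp add: corner_sum_adj_Cons distrib_right word_sum_add)
  finally show ?case .
qed simp

section \<open>Sign-imbalances as iterated corner removals\<close>

definition empty_word :: "nat \<Rightarrow> bool list"
    where "empty_word N = replicate N False @ replicate N True"

text \<open>The second argument is the size: \<open>imbalance N n\<close> is the vector of
  sign-imbalances of the shapes with \<open>n\<close> squares in the box, zero on all other words.
  \<open>sign_imbalance_word\<close> makes the identification.\<close>

primrec imbalance :: "nat \<Rightarrow> nat \<Rightarrow> bool list \<Rightarrow> real" where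
  "imbalance N 0 l = (if l = empty_word N then 1 else 0)"
| "imbalance N (Suc n) l = corner_sum (imbalance N n) l"

lemma horiz_app [simp]: "horiz (a @ b) = horiz a + horiz b" by (induction a) auto

lemma horiz_rep [simp]: "horiz (replicate k x) = (if x then 0 else k)" by (induction k) auto

lemma area_rep [simp]: "area (replicate k x) = 0" by (induction k) auto

lemma area_app: "area (a @ b) = area a + area b + (length a - horiz a) * horiz b"
proof (induction a)
  case (Cons x a)
  have "horiz a \<le> length a" by (induction a) auto
  with Cons show ?case by (cases x) (auto simp: Suc_diff_le)
qed simp

lemma empty_word_simps [simp]: "length (empty_word N) = 2 * N" "horiz (empty_word N) =
    N" "area (empty_word N) = 0"
  by (simp_all add: empty_word_def area_app)

lemma imbalance_nz: "imbalance N n l \<noteq> 0 \<Longrightarrow>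
    length l = 2 * N \<and> horiz l = N \<and> area l = n"
proof (induction n arbitrary: l)
  case 0 then show ?case by (simp split: if_splits)
next
  case (Suc n)
  then obtain t where "length t = length l" "horiz t = horiz l" "Suc (area t) =
      area l" "imbalance N n t \<noteq> 0"
    using corner_sum_nz[of "imbalance N n" l] by auto
  then show ?case using Suc.IH[of t] by simp
qed

lemma area0_word: "area l = 0 \<Longrightarrow>
    l = replicate (horiz l) False @ replicate (length l - horiz l) True"
proof (induction l)
  case (Cons b l)
  have "horiz l \<le> length l" by (induction l) auto
  then show ?case using Cons by (cases b) (auto simp: Suc_diff_le)
qed simp

text \<open>A leading vertical step ends a row of full width. Together with \<open>area_last\<close>
  this keeps words of area below \<open>N\<close> away from the sides of the box, as the commutation
  relations require.\<close>

lemma area_hd: "hd l \<Longrightarrow> l \<noteq> [] \<Longrightarrow> horiz l \<le> area l"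
    by (cases l) auto

text \<open>A final horizontal step leaves no row empty, and there are
  \<open>length l - horiz l\<close> rows.\<close>

lemma area_last: "\<not> last l \<Longrightarrow> l \<noteq> [] \<Longrightarrow>
    length l - horiz l \<le> area l"
proof -
  assume "\<not> last l" "l \<noteq> []"
  then obtain k where "l = k @ [False]" by (metis append_butlast_last_id)
  then show ?thesis by (simp add: area_app)
qed

text \<open>The factor by which a kernel with scalar \<open>\<kappa>\<close> carries imbalances of
  size \<open>n\<close> to size \<open>a\<close>. The recursion is the commutation relation, with
  \<open>(-1) ^ (n + a)\<close> as relative sign of the sizes.\<close>

primrec ladder_coeff :: "(real \<Rightarrow> real) \<Rightarrow> nat \<Rightarrow> nat
    \<Rightarrow> real" where
  "ladder_coeff \<kappa> 0 a = (if a = 0 then 1 else 0)"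
| "ladder_coeff \<kappa> (Suc n) a =
    - ((-1) ^ (n + a)) * (case a of 0 \<Rightarrow> 0 | Suc a' \<Rightarrow> ladder_coeff \<kappa>
    n a') + \<kappa> ((-1) ^ (n + a)) * ladder_coeff \<kappa> n a"

lemma ladder_coeff_0: "n < a \<Longrightarrow> ladder_coeff \<kappa> n a = 0"
  by (induction n arbitrary: a) (auto split: nat.split)

text \<open>Induction on the size: one corner removal in \<open>imbalance\<close> is transposed onto
  the outer word of \<open>K\<close>, and \<open>comm\<close> trades it for a removal from the inner
  word and a multiple of \<open>K\<close>. The bound \<open>n < N\<close> ensures that
  \<open>comm\<close> applies.\<close>

lemma kernel_imbalance:
  fixes K :: "bool list \<Rightarrow> bool list \<Rightarrow> real"
  assumes nz: "\<And>m l. length m = length l \<Longrightarrow> K m l \<noteq> 0 \<Longrightarrow>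
      horiz m = horiz l \<and> area m \<le> area l"
    and id: "\<And>m. K m m = 1"
    and comm: "\<And>m l. length m = 2 * N \<Longrightarrow> length l = 2 * N \<Longrightarrow>
        horiz m = N \<Longrightarrow> horiz l = N \<Longrightarrow> \<not> hd m \<Longrightarrow>
        \<not> hd l \<Longrightarrow> last m \<Longrightarrow> last l \<Longrightarrow>
      corner_sum_adj (K m) l + area_sign l * area_sign m * corner_sum (\<lambda>t. K t l) m =
          \<kappa> (area_sign l * area_sign m) * K m l"
  shows "n < N \<Longrightarrow> length m = 2 * N \<Longrightarrow>
      word_sum (2 * N) (\<lambda>l. K m l * imbalance N n l) =
      ladder_coeff \<kappa> n (area m) * imbalance N (area m) m"
proof (induction n arbitrary: m)
  case 0
  have "word_sum (2 * N) (\<lambda>l. K m l * imbalance N 0 l) = (\<Sum>l | length l =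
      2 * N. if l = empty_word N then K m l else 0)"
    unfolding word_sum_eq_sum by (rule sum.cong) auto
  also have "\<dots> = K m (empty_word N)"
    using finite_lists_length_eq[of "UNIV :: bool set" "2 * N"] by (subst sum.delta) auto
  also have "\<dots> = ladder_coeff \<kappa> 0 (area m) * imbalance N (area m) m"
  proof (cases "K m (empty_word N) = 0")
    case False
    then have "horiz m = N" "area m = 0" using nz[of m "empty_word N"] 0 by auto
    then have "m = empty_word N" using area0_word[of m] 0 by (simp add: empty_word_def)
    then show ?thesis using id by simp
  next
    case True
    then have "m \<noteq> empty_word N" using id[of m] by auto
    then show ?thesis using True by auto
  qed
  finally show ?case .
next
  case (Suc n)
  show ?case
  proof (cases "horiz m = N \<and> area m \<le> Suc n")
    \<comment> \<open>Both sides vanish: the left by \<open>nz\<close>, the right because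
      \<open>imbalance\<close> is zero outside the box and \<open>ladder_coeff\<close> is zero above
      the diagonal.\<close>
    case False
    have "K m l * imbalance N (Suc n) l = 0" if "length l = 2 * N" for l
      using False nz[of m l] imbalance_nz[of N "Suc n" l] that Suc.prems by fastforce
    then have "word_sum (2 * N) (\<lambda>l. K m l * imbalance N (Suc n) l) =
        word_sum (2 * N) (\<lambda>l. 0)"
      by (intro word_sum_cong) auto
    moreover have "ladder_coeff \<kappa> (Suc n) (area m) * imbalance N (area m) m = 0"
      using False ladder_coeff_0[of "Suc n" "area m" \<kappa>] imbalance_nz[of N "area m" m] by auto
    ultimately show ?thesis by simp
  next
    case True
    let ?s = "(-1) ^ (n + area m) :: real"
    have ne: "m \<noteq> []" using Suc.prems by auto
    have hm: "\<not> hd m" "last m"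
        using area_hd[of m] area_last[of m] ne True Suc.prems by fastforce+
    have "word_sum (2 * N) (\<lambda>l. K m l * imbalance N (Suc n) l) =
        word_sum (2 * N) (\<lambda>l. corner_sum_adj (K m) l * imbalance N n l)"
      by (simp add: corner_sum_adjoint)
    also have "\<dots> = word_sum (2 * N) (\<lambda>l. (- ?s) * (corner_sum (\<lambda>t.
        K t l) m * imbalance N n l) + \<kappa> ?s * (K m l * imbalance N n l))"
    proof (rule word_sum_cong)
      fix l :: "bool list" assume l: "length l = 2 * N"
      show "corner_sum_adj (K m) l * imbalance N n l =
          (- ?s) * (corner_sum (\<lambda>t. K t l) m * imbalance N n l) +
          \<kappa> ?s * (K m l * imbalance N n l)"
      proof (cases "imbalance N n l = 0")
        case False
        then have p: "horiz l = N" "area l = n" using imbalance_nz[of N n l] by auto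
        have "l \<noteq> []" using l Suc.prems by auto
        then have "\<not> hd l" "last l"
            using area_hd[of l] area_last[of l] p l Suc.prems by fastforce+
        then have "corner_sum_adj (K m) l +
            area_sign l * area_sign m * corner_sum (\<lambda>t. K t l) m =
            \<kappa> (area_sign l * area_sign m) * K m l"
          using comm[of m l] hm True l p Suc.prems by auto
        moreover have "area_sign l * area_sign m = ?s" by (simp add: area_sign_def p power_add)
        ultimately have "corner_sum_adj (K m) l + ?s * corner_sum (\<lambda>t. K t l) m =
            \<kappa> ?s * K m l" by (simp only:)
        then have "corner_sum_adj (K m) l =
            \<kappa> ?s * K m l - ?s * corner_sum (\<lambda>t. K t l) m" by linarith
        then show ?thesis by (simp add: left_diff_distrib)
      qed simp
    qed
    also have "\<dots> = (- ?s) * word_sum (2 * N) (\<lambda>l. corner_sum (\<lambda>t.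
        K t l * imbalance N n l) m) + \<kappa> ?s * word_sum (2 * N) (\<lambda>l.
        K m l * imbalance N n l)"
    proof -
      have "corner_sum (\<lambda>t. K t l) m * imbalance N n l =
          corner_sum (\<lambda>t. K t l * imbalance N n l) m" for l
        using corner_sum_cmult[of "imbalance N n l" "\<lambda>t. K t l" m]
            by (simp add: mult.commute)
      then show ?thesis by (simp only: word_sum_add word_sum_cmult)
    qed
    \<comment> \<open>The operator touches only the inner word, so it leaves the sum over outer
      words, where the induction hypothesis holds one size lower.\<close>
    also have "word_sum (2 * N) (\<lambda>l. corner_sum (\<lambda>t. K t l * imbalance N n l) m) =
        corner_sum (\<lambda>t. word_sum (2 * N) (\<lambda>l. K t l * imbalance N n l)) m"
      by (simp add: corner_sum_word_sum)
    also have "\<dots> = (case area m of 0 \<Rightarrow> 0 | Suc a \<Rightarrow> ladder_coeff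
        \<kappa> n a) * imbalance N (area m) m"
    proof (cases "area m")
      case 0
      then show ?thesis using corner_sum_nz[of "\<lambda>t. word_sum (2 * N) (\<lambda>l.
          K t l * imbalance N n l)" m] by auto
    next
      case (Suc a)
      have "corner_sum (\<lambda>t. word_sum (2 * N) (\<lambda>l. K t l * imbalance N n l)) m =
          corner_sum (\<lambda>t. ladder_coeff \<kappa> n a * imbalance N a t) m"
        by (rule corner_sum_cong_on) (use Suc Suc.IH Suc.prems in auto)
      then show ?thesis using Suc by (simp add: corner_sum_cmult)
    qed
    also have "word_sum (2 * N) (\<lambda>l. K m l * imbalance N n l) =
        ladder_coeff \<kappa> n (area m) * imbalance N (area m) m"
      by (rule Suc.IH) (use Suc.prems in auto)
    finally show ?thesis by (simp add: algebra_simps)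
  qed
qed

section \<open>Action of the three kernels on the sign-imbalances\<close>

lemma hstrip_id: "hstrip X False m m = 1" by (induction m) auto

lemma vstrip_id: "vstrip False r m m = 1" by (induction m) auto

lemma black_kernel_id: "black_kernel w False r m m = 1" by (induction m arbitrary: r) auto

text \<open>With \<open>d\<close> set the outer word has already closed one more row; the term
  \<open>horiz l\<close> makes up for it.\<close>

lemma hstrip_nz: "hstrip X d m l \<noteq> 0 \<Longrightarrow>
    horiz l = horiz m + of_bool d \<and> area m \<le> area l + (if d then horiz l else 0)"
  by (induction d m l rule: hstrip.induct) (auto split: if_splits)

lemma vstrip_nz: "vstrip d r m l \<noteq> 0 \<Longrightarrow>
    horiz l = horiz m + of_bool d \<and> area m \<le> area l + (if d then horiz l else 0)"
  by (induction d r m l rule: vstrip.induct) (auto split: if_splits)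

lemma black_kernel_nz: "black_kernel w d r m l \<noteq> 0 \<Longrightarrow>
    horiz l = horiz m + of_bool d \<and> area m \<le> area l + (if d then horiz l else 0)"
  by (induction d r m l rule: black_kernel.induct) (auto split: if_splits)

lemma hstrip_imbalance:
  assumes "n < N" "length m = 2 * N"
  shows "word_sum (2 * N) (\<lambda>l. hstrip X False m l * imbalance N n l) =
      ladder_coeff (\<lambda>s. - s * X) n (area m) * imbalance N (area m) m"
proof (rule kernel_imbalance[OF _ _ _ assms])
  fix m l :: "bool list" assume "length m = 2 * N" "length l = 2 * N" "horiz m = N" "horiz l =
      N" "\<not> hd m" "\<not> hd l" "last m" "last l"
  moreover from this have "m \<noteq> []" using assms by auto
  ultimately show "corner_sum_adj (hstrip X False m) l +
      area_sign l * area_sign m * corner_sum (\<lambda>t. hstrip X False t l) m =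
      - (area_sign l * area_sign m) * X * hstrip X False m l"
    using hstrip_comm[of m l False X] by (simp add: horiz_sign_def)
next
  fix m l assume "hstrip X False m l \<noteq> 0" then show "horiz m =
      horiz l \<and> area m \<le> area l" using hstrip_nz[of X False m l] by simp
qed (simp add: hstrip_id)

lemma vstrip_imbalance:
  assumes "n < N" "length m = 2 * N"
  shows "word_sum (2 * N) (\<lambda>l. vstrip False 1 m l * imbalance N n l) =
      ladder_coeff (\<lambda>s. - 1) n (area m) * imbalance N (area m) m"
proof (rule kernel_imbalance[OF _ _ _ assms])
  fix m l :: "bool list" assume "length m = 2 * N" "length l = 2 * N" "horiz m = N" "horiz l =
      N" "\<not> hd m" "\<not> hd l" "last m" "last l"
  moreover from this have "m \<noteq> []" using assms by auto
  ultimately show "corner_sum_adj (vstrip False 1 m) l +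
      area_sign l * area_sign m * corner_sum (\<lambda>t. vstrip False 1 t l) m =
      - 1 * vstrip False 1 m l"
    using vstrip_comm[of m l False 1] by (simp add: horiz_sign_def)
next
  fix m l assume "vstrip False 1 m l \<noteq> 0" then show "horiz m =
      horiz l \<and> area m \<le> area l" using vstrip_nz[of False 1 m l] by simp
qed (simp add: vstrip_id)

text \<open>The diagonal entry is carried over with sign +1, since \<open>s = -1\<close> at
  \<open>a = Suc n\<close>. At \<open>a = n\<close> the sign is \<open>s = 1\<close>, where the
  scalar vanishes, so nothing appears below the diagonal.\<close>

lemma ladder_coeff_delta: "ladder_coeff (\<lambda>s. w * (1 - s) / 2) n a = of_bool (a = n)"
proof (induction n arbitrary: a)
  case step: (Suc n)
  consider "a = Suc n" | "a = n" | "a \<noteq> n" "a \<noteq> Suc n" by blast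
  then show ?case
  proof cases
    case 2
    have "(case n of 0 \<Rightarrow> 0 | Suc a \<Rightarrow> ladder_coeff (\<lambda>s.
        w * (1 - s) / 2) n a) = 0"
    proof (cases n)
      case (Suc k)
      then show ?thesis using step.IH[of k] by (simp del: ladder_coeff.simps)
    qed simp
    with 2 show ?thesis by simp
  next
    case 3
    then show ?thesis using step by (cases a) auto
  qed (use step in auto)
qed auto

text \<open>Removals of non-empty sets of black corners cancel in total, so the black corner sum is
  the identity on the imbalances. An even \<open>N\<close> puts the main diagonal among the white
  ones.\<close>

lemma black_kernel_imbalance:
  assumes "n < N" "length m = 2 * N" "even N"
  shows "word_sum (2 * N) (\<lambda>l. black_kernel w False False m l * imbalance N n l) =
      of_bool (area m = n) * imbalance N n m"
proof -
  have "word_sum (2 * N) (\<lambda>l. black_kernel w False False m l * imbalance N n l) =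
      ladder_coeff (\<lambda>s. w * (1 - s) / 2) n (area m) * imbalance N (area m) m"
  proof (rule kernel_imbalance[OF _ _ _ assms(1,2)])
    fix m l :: "bool list" assume "length m = 2 * N" "length l = 2 * N" "horiz m = N" "horiz l =
        N" "\<not> hd m" "\<not> hd l" "last m" "last l"
    then show "corner_sum_adj (black_kernel w False False m) l +
        area_sign l * area_sign m * corner_sum (\<lambda>t. black_kernel w False False t l) m =
        w * (1 - area_sign l * area_sign m) / 2 * black_kernel w False False m l"
      using black_kernel_comm[of m l False False w] \<open>even N\<close>
          by (simp add: horiz_sign_def)
  next
    fix m l assume "black_kernel w False False m l \<noteq> 0" then show "horiz m =
        horiz l \<and> area m \<le> area l" using black_kernel_nz[of w False False m l] by simp
  qed (simp add: black_kernel_id)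
  then show ?thesis by (auto simp: ladder_coeff_delta)
qed

section \<open>Composition of a horizontal and a vertical strip\<close>

context fixes X :: real begin
text \<open>The first square of a component may lie in either strip, whence \<open>X + r\<close>. A
  square below its predecessor must lie in the vertical strip, one to its left in the horizontal
  strip.\<close>

fun strip_kernel :: "bool \<Rightarrow> real \<Rightarrow> bool list \<Rightarrow> bool list
    \<Rightarrow> real" where
  "strip_kernel d r [] [] = (if d then 0 else 1)"
| "strip_kernel False r (a # m) (b # l) = (if a =
    b then strip_kernel False r m l else if b then (X +
    r) * (step_sign l * strip_kernel True (- r) m l) else 0)"
| "strip_kernel True r (a # m) (b # l) =
    (if a \<and> \<not> b then strip_kernel False r m l else if \<not> a \<and> b then
    0 else (if a then r else X) * (step_sign l * strip_kernel True (- r) m l))"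
| "strip_kernel _ _ _ _ = 0"
end

text \<open>Passing from the intermediate to the outer word costs one sign per square of the
  vertical strip, which is the effect of negating \<open>r\<close>.\<close>

lemma step_sign_vstrip: "length m = length l \<Longrightarrow>
    step_sign m * vstrip False r m l = step_sign l * vstrip False (- r) m l"
proof (cases "horiz m = horiz l")
  case True
  assume "length m = length l"
  with True have "vstrip False (- r) m l = area_sign l * area_sign m * vstrip False r m l"
      using vstrip_neg[of m l False r] by (simp add: horiz_sign_def)
  then show ?thesis using True by (simp add: step_sign_def horiz_sign_def area_sign_sq)
next
  case False
  then have "vstrip False r m l = 0" "vstrip False (- r) m l = 0"
      by (metis vstrip_nz add_0_right of_bool_eq(1))+
  then show ?thesis by simp
qed

text \<open>The middle word would have to begin with \<open>False\<close> for the first factor and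
  with \<open>True\<close> for the second.\<close>

lemma hstrip_vstrip_zero: "length m = k \<Longrightarrow> length l = k \<Longrightarrow>
    hstrip X True m l * vstrip True r l l' = 0"
  by (cases m; cases l; cases l') auto

text \<open>A square on the current diagonal lies in exactly one of the strips. Both alternatives
  leave the same sum over the rest, so a single flag suffices for the composition.\<close>

lemma hstrip_vstrip:
  assumes "length m = length l"
  shows "word_sum (length m) (\<lambda>k. hstrip X False m k * vstrip False r k l) =
      strip_kernel X False r m l"
    "word_sum (length m) (\<lambda>k. hstrip X True m k * vstrip False r k l) =
        strip_kernel X True r m l"
    "word_sum (length m) (\<lambda>k. hstrip X False m k * vstrip True r k l) =
        strip_kernel X True r m l"
proof -
  have "word_sum (length m) (\<lambda>k. hstrip X False m k * vstrip False r k l) =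
      strip_kernel X False r m l \<and>
    word_sum (length m) (\<lambda>k. hstrip X True m k * vstrip False r k l) =
        strip_kernel X True r m l \<and>
    word_sum (length m) (\<lambda>k. hstrip X False m k * vstrip True r k l) =
        strip_kernel X True r m l"
    using assms
  proof (induction m arbitrary: l r)
    case Nil then show ?case by simp
  next
    case (Cons a m)
    then obtain b l' where l: "l = b # l'" and len: "length m = length l'" by (cases l) auto
    note IH = Cons.IH[OF len]
    \<comment> \<open>The next square lies in the horizontal strip (\<open>A\<close>) or in the
      vertical one (\<open>B\<close>); \<open>Z\<close> is the excluded case of two squares on
      adjacent diagonals whose flags conflict.\<close>
    have A: "word_sum (length l') (\<lambda>k.
        X * (step_sign k * hstrip X True m k) * vstrip False r k l') =
        X * (step_sign l' * strip_kernel X True (- r) m l')"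
    proof -
      have "word_sum (length l') (\<lambda>k.
          X * (step_sign k * hstrip X True m k) * vstrip False r k l') =
          word_sum (length l') (\<lambda>k.
          (X * step_sign l') * (hstrip X True m k * vstrip False (- r) k l'))"
        by (rule word_sum_cong) (use step_sign_vstrip[of _ l' r] in \<open>simp add:
            ac_simps\<close>)
      then show ?thesis using IH[of "- r"] len by (simp add: word_sum_cmult)
    qed
    have B: "word_sum (length l') (\<lambda>k.
        hstrip X False m k * (r * (step_sign l' * vstrip True (- r) k l'))) =
        r * (step_sign l' * strip_kernel X True (- r) m l')"
    proof -
      have "word_sum (length l') (\<lambda>k.
          hstrip X False m k * (r * (step_sign l' * vstrip True (- r) k l'))) =
          word_sum (length l') (\<lambda>k.
          (r * step_sign l') * (hstrip X False m k * vstrip True (- r) k l'))"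
        by (rule word_sum_cong) (simp add: ac_simps)
      then show ?thesis using IH[of "- r"] len by (simp add: word_sum_cmult)
    qed
    have Z: "word_sum (length l') (\<lambda>k.
        X * (step_sign k * hstrip X True m k) * (r * (step_sign l' * vstrip True (- r) k l'))) = 0"
    proof -
      have "word_sum (length l') (\<lambda>k.
          X * (step_sign k * hstrip X True m k) * (r * (step_sign l' * vstrip True (- r) k l'))) =
          word_sum (length l') (\<lambda>k. 0)"
        by (rule word_sum_cong) (use hstrip_vstrip_zero[of m "length l'" _ X "- r" l'] len in
            \<open>auto\<close>)
      then show ?thesis by simp
    qed
    show ?case using IH[of r] A B Z unfolding l
        by (cases a; cases b) (simp_all add: len distrib_right)
  qed
  then show "word_sum (length m) (\<lambda>k. hstrip X False m k * vstrip False r k l) =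
      strip_kernel X False r m l"
    "word_sum (length m) (\<lambda>k. hstrip X True m k * vstrip False r k l) =
        strip_kernel X True r m l"
    "word_sum (length m) (\<lambda>k. hstrip X False m k * vstrip True r k l) =
        strip_kernel X True r m l" by auto
qed

text \<open>Summing over the vertical strip leaves multiples of the imbalances of the intermediate
  shapes; the horizontal strip carries each size among these to a multiple of the imbalance of
  \<open>m\<close>, which is zero.\<close>

lemma strip_kernel_imbalance:
  assumes "n < N" "length m = 2 * N" "imbalance N (area m) m = 0"
  shows "word_sum (2 * N) (\<lambda>l. strip_kernel X False 1 m l * imbalance N n l) = 0"
proof -
  have "word_sum (2 * N) (\<lambda>l. strip_kernel X False 1 m l * imbalance N n l) =
    word_sum (2 * N) (\<lambda>l. word_sum (2 * N) (\<lambda>k.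
        hstrip X False m k * (vstrip False 1 k l * imbalance N n l)))"
  proof (rule word_sum_cong)
    fix l :: "bool list" assume "length l = 2 * N"
    then have "strip_kernel X False 1 m l =
        word_sum (2 * N) (\<lambda>k. hstrip X False m k * vstrip False 1 k l)"
      using hstrip_vstrip(1)[of m l X 1] assms by simp
    then show "strip_kernel X False 1 m l * imbalance N n l =
        word_sum (2 * N) (\<lambda>k. hstrip X False m k * (vstrip False 1 k l * imbalance N n l))"
      using word_sum_cmult[of "2 * N" "imbalance N n l" "\<lambda>k.
          hstrip X False m k * vstrip False 1 k l"] by (simp add: ac_simps)
  qed
  also have "\<dots> = word_sum (2 * N) (\<lambda>k.
      hstrip X False m k * (ladder_coeff (\<lambda>s. - 1) n (area k) * imbalance N (area k) k))"
    by (subst word_sum_swap, rule word_sum_cong) (simp add: word_sum_cmult vstrip_imbalance assms)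
  \<comment> \<open>The intermediate size varies, so the sum is split by it; sizes above
    \<open>n\<close> have coefficient zero.\<close>
  also have "\<dots> = word_sum (2 * N) (\<lambda>k. \<Sum>j\<le>n. ladder_coeff (\<lambda>s.
      - 1) n j * (hstrip X False m k * imbalance N j k))"
  proof (rule word_sum_cong)
    fix k
    have "(\<Sum>j\<le>n. ladder_coeff (\<lambda>s.
        - 1) n j * (hstrip X False m k * imbalance N j k)) = (\<Sum>j\<le>n. if j =
        area k then ladder_coeff (\<lambda>s.
        - 1) n j * (hstrip X False m k * imbalance N j k) else 0)"
    proof (rule sum.cong)
      fix j
      show "ladder_coeff (\<lambda>s. - 1) n j * (hstrip X False m k * imbalance N j k) = (if j =
          area k then ladder_coeff (\<lambda>s.
          - 1) n j * (hstrip X False m k * imbalance N j k) else 0)"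
        using imbalance_nz[of N j k] by (cases "imbalance N j k = 0") auto
    qed simp
    then show "hstrip X False m k * (ladder_coeff (\<lambda>s.
        - 1) n (area k) * imbalance N (area k) k) =
        (\<Sum>j\<le>n. ladder_coeff (\<lambda>s.
        - 1) n j * (hstrip X False m k * imbalance N j k))"
      by (simp add: ladder_coeff_0 not_le)
  qed
  also have "\<dots> = (\<Sum>j\<le>n. ladder_coeff (\<lambda>s.
      - 1) n j * word_sum (2 * N) (\<lambda>k. hstrip X False m k * imbalance N j k))"
    unfolding word_sum_eq_sum by (subst sum.swap) (simp add: sum_distrib_left)
  also have "\<dots> = 0"
  proof (rule sum.neutral, rule ballI)
    fix j assume "j \<in> {..n}"
    then have "j < N" using assms(1) by simp
    from hstrip_imbalance[OF this assms(2), of X] assms(3)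
    show "ladder_coeff (\<lambda>s. - 1) n j * word_sum (2 * N) (\<lambda>k.
        hstrip X False m k * imbalance N j k) = 0" by simp
  qed
  finally show ?thesis .
qed

section \<open>Black and white squares\<close>

text \<open>
  Black diagonals lie inside the letter pairs at positions \<open>2 i, 2 i + 1\<close>, and
  white ones between consecutive pairs.
\<close>

fun black_sum :: "(bool list \<Rightarrow> real) \<Rightarrow> bool list \<Rightarrow> real" where
  "black_sum f (x # y # s) = (if x \<and> \<not> y then
      area_sign s * f (False # True # s) else 0) + black_sum (\<lambda>t. f (x # y # t)) s"
| "black_sum f _ = 0"

definition white_sum :: "(bool list \<Rightarrow> real) \<Rightarrow> bool list \<Rightarrow> real"
    where
  "white_sum f l = (case l of [] \<Rightarrow> 0 | x # l' \<Rightarrow> black_sum (\<lambda>t.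
      f (x # t)) l')"

lemma white_sum_simps [simp]: "white_sum f [] = 0" "white_sum f (x # l) =
    black_sum (\<lambda>t. f (x # t)) l"
  by (simp_all add: white_sum_def)

lemma corner_sum_split: "corner_sum f l = black_sum f l + white_sum f l"
proof (induction f l rule: corner_sum.induct)
  case (1 f x y s)
  then show ?case by simp
qed auto

lemma black_sum_add: "black_sum (\<lambda>t. f t + g t) l = black_sum f l + black_sum g l"
proof (induction f l arbitrary: g rule: black_sum.induct)
  case (1 f x y s)
  show ?case using 1[of "\<lambda>t. g (x # y # t)"] by (simp add: distrib_left)
qed auto

lemma black_sum_nz: "black_sum f l \<noteq> 0 \<Longrightarrow>
    \<exists>p s. even (length p) \<and> l =
    p @ True # False # s \<and> f (p @ False # True # s) \<noteq> 0"
proof (induction f l rule: black_sum.induct)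
  case (1 f x y s)
  show ?case
  proof (cases "x \<and> \<not> y \<and> f (False # True # s) \<noteq> 0")
    case True
    then show ?thesis by (intro exI[of _ "[]"] exI[of _ s]) simp
  next
    case False
    then have "black_sum (\<lambda>t. f (x # y # t)) s \<noteq> 0" using 1(2)
        by (auto split: if_splits)
    then obtain p q where "even (length p)" "s =
        p @ True # False # q" "f (x # y # p @ False # True # q) \<noteq> 0"
      using 1(1) by blast
    then show ?thesis by (intro exI[of _ "x # y # p"] exI[of _ q]) simp
  qed
qed auto

lemma black_sum_cmult: "black_sum (\<lambda>t. c * f t) l = c * black_sum f l"
proof (induction f l rule: black_sum.induct)
  case (1 f x y s)
  then show ?case by (simp add: distrib_left)
qed auto

lemma black_sum_cong_on: "(\<And>t. length t = length l \<Longrightarrow>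
    horiz t = horiz l \<Longrightarrow> Suc (area t) = area l \<Longrightarrow>
    f t = g t) \<Longrightarrow> black_sum f l = black_sum g l"
proof (induction f l arbitrary: g rule: black_sum.induct)
  case (1 f x y s)
  have "black_sum (\<lambda>t. f (x # y # t)) s = black_sum (\<lambda>t. g (x # y # t)) s"
    by (rule 1(1)) (rule 1(2), simp_all)
  moreover have "f (False # True # s) = g (False # True # s)" if "x \<and> \<not> y"
    by (rule 1(2)) (use that in simp_all)
  ultimately show ?case by simp
qed auto

lemma black_sum_area_sign: "black_sum (\<lambda>t. area_sign t * f t) l =
    - area_sign l * black_sum f l"
proof -
  have "black_sum (\<lambda>t. area_sign t * f t) l = black_sum (\<lambda>t. - area_sign l * f t) l"
  proof (rule black_sum_cong_on)
    fix t assume "Suc (area t) = area l"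
    then have "area_sign l = - area_sign t"
        by (simp add: area_sign_def flip: \<open>Suc (area t) = area l\<close>)
    then show "area_sign t * f t = - area_sign l * f t" by simp
  qed
  then show ?thesis by (simp add: black_sum_cmult[of "- area_sign l", simplified])
qed

text \<open>Black corners lie in disjoint pairs of letters, so two of them can be removed in either
  order. Removing the later one first changes by one the area behind the earlier one, so the two
  orders cancel.\<close>

lemma black_sum_squared: "black_sum (black_sum f) l = 0"
proof (induction f l rule: black_sum.induct)
  case (1 f x y s)
  have "black_sum (\<lambda>t. black_sum f (x # y # t)) s =
     black_sum (\<lambda>t. (if x \<and> \<not> y then
         1 else 0) * (area_sign t * f (False # True # t)) +
         black_sum (\<lambda>u. f (x # y # u)) t) s"
    by (rule black_sum_cong_on) simp
  also have "\<dots> = (if x \<and> \<not> y then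
      1 else 0) * (- area_sign s * black_sum (\<lambda>t. f (False # True # t)) s)"
    by (simp only: black_sum_add black_sum_cmult black_sum_area_sign 1 add_0_right)
  finally show ?case by (simp del: black_sum.simps add: black_sum.simps(1)[of "black_sum f"]) simp
qed auto

lemma white_sum_squared: "white_sum (white_sum f) l = 0"
  by (cases l) (simp_all add: black_sum_squared)

text \<open>
  On boundary words of shapes this is twice the number of white squares minus twice the number of
  black ones.
\<close>

primrec balance :: "bool list \<Rightarrow> int" where
  "balance [] = 0" | "balance (b # l) = - of_bool b - balance l"

lemma balance_app: "balance (p @ q) =
    balance p + (if even (length p) then balance q else - balance q)"
  by (induction p) auto

lemma balance_rep: "even k \<Longrightarrow> balance (replicate k b) = 0"
proof -
  have "balance (replicate (2 * j) b) = 0" for j by (induction j) auto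
  then show "even k \<Longrightarrow> balance (replicate k b) = 0" by (auto elim!: evenE)
qed

lemma black_sum_balance: "black_sum f l \<noteq> 0 \<Longrightarrow>
    \<exists>t. f t \<noteq> 0 \<and> balance t = balance l + 2"
proof -
  assume "black_sum f l \<noteq> 0"
  then obtain p s where "even (length p)" "l =
      p @ True # False # s" "f (p @ False # True # s) \<noteq> 0"
    using black_sum_nz by blast
  then show ?thesis by (intro exI[of _ "p @ False # True # s"]) (simp add: balance_app)
qed

lemma white_sum_balance: "white_sum f l \<noteq> 0 \<Longrightarrow>
    \<exists>t. f t \<noteq> 0 \<and> balance t = balance l - 2"
proof (cases l)
  case (Cons x l')
  assume "white_sum f l \<noteq> 0"
  then obtain t where "f (x # t) \<noteq> 0" "balance t = balance l' + 2"
      using black_sum_balance[of "\<lambda>t. f (x # t)" l'] Cons by auto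
  then show ?thesis using Cons by (intro exI[of _ "x # t"]) simp
qed simp

text \<open>The only square that can be added to the empty shape sits at positions
  \<open>N - 1\<close> and \<open>N\<close>, which belong to different pairs when \<open>N\<close>
  is even: it is white.\<close>

lemma black_sum_empty_word: assumes "even N" shows "black_sum (imbalance N 0) l = 0"
proof (rule ccontr)
  assume "black_sum (imbalance N 0) l \<noteq> 0"
  then obtain p s where p: "even (length p)" "imbalance N 0 (p @ False # True # s) \<noteq> 0"
      using black_sum_nz by blast
  then have eq: "p @ False # True # s = empty_word N" by (simp split: if_splits)
  have nth: "empty_word N ! i \<longleftrightarrow> N \<le> i" if "i < 2 * N" for i
    using that by (simp add: empty_word_def nth_append)
  have "length (p @ False # True # s) = 2 * N" unfolding eq by simp
  then have "Suc (length p) < 2 * N" by simp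
  moreover have "\<not> (p @ False # True # s) ! length p" "(p @ False # True # s) ! Suc (length p)"
    by (simp_all add: nth_append)
  ultimately have "length p < N" "N \<le> Suc (length p)"
    using nth[of "length p"] nth[of "Suc (length p)"] unfolding eq by auto
  then have "N = Suc (length p)" by simp
  then show False using p assms by simp
qed

text \<open>Both halves of the corner operator square to zero and the first square is white. Hence
  white and black steps alternate, and so does the colour excess between 0 and 1.\<close>

lemma imbalance_chess: assumes "even N"
  shows "(\<forall>l. imbalance N n l \<noteq> 0 \<longrightarrow> balance l =
      2 * of_bool (odd n)) \<and> (if even n then black_sum (imbalance N n) =
      (\<lambda>_. 0) else white_sum (imbalance N n) = (\<lambda>_. 0))"
proof (induction n)
  case 0
  have "balance (empty_word N) = 0" using assms
      by (simp add: empty_word_def balance_app balance_rep)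
  then show ?case using black_sum_empty_word[OF assms] by (simp add: fun_eq_iff)
next
  case (Suc n)
  show ?case
  proof (cases "even n")
    case True
    then have eq: "imbalance N (Suc n) = white_sum (imbalance N n)" using Suc
        by (simp add: fun_eq_iff corner_sum_split)
    have "balance l = 2" if "white_sum (imbalance N n) l \<noteq> 0" for l
        using white_sum_balance[OF that] Suc True by auto
    then show ?thesis using True unfolding eq by (auto simp: fun_eq_iff white_sum_squared)
  next
    case False
    then have eq: "imbalance N (Suc n) = black_sum (imbalance N n)" using Suc
        by (simp add: fun_eq_iff corner_sum_split)
    have "balance l = 0" if "black_sum (imbalance N n) l \<noteq> 0" for l
        using black_sum_balance[OF that] Suc False by auto
    then show ?thesis using False unfolding eq by (auto simp: fun_eq_iff black_sum_squared)
  qed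
qed

section \<open>Fourling shapes as words of equal pairs\<close>

fun paired :: "bool list \<Rightarrow> bool" where
  "paired [] = True"
| "paired [x] = False"
| "paired (x # y # s) = (x = y \<and> paired s)"

lemma paired_even: "paired l \<Longrightarrow> even (length l) \<and> even (horiz l) \<and>
    even (area l)"
  by (induction l rule: paired.induct) auto

lemma black_sum_paired: "paired l \<Longrightarrow> black_sum f l = 0"
  by (induction f l rule: black_sum.induct) auto

text \<open>The area is even, so by \<open>imbalance_chess\<close> only black corners contribute to
  the imbalance, and a paired word has none.\<close>

lemma imbalance_paired: assumes "even N" "paired l" "area l > 0" shows "imbalance N (area l) l = 0"
proof -
  obtain n where n: "area l = Suc n" using assms by (cases "area l") auto
  then have "odd n" using paired_even[OF assms(2)] by simp
  then show ?thesis using imbalance_chess[OF assms(1), of n]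
      by (simp add: n corner_sum_split black_sum_paired assms(2))
qed

text \<open>
  In the boundary word of a fourling shape both letters of each pair agree. The flag
  \<open>W\<close> tells whether the diagonal between the two surrounding pairs meets the strip.
\<close>

context fixes x :: real begin
fun body_weight :: "bool \<Rightarrow> bool list \<Rightarrow> bool list \<Rightarrow> real" where
  "body_weight W [] [] = (if W then 0 else 1)"
| "body_weight W (a # a' # D) (b # b' # l) =
    (if a = b \<and> a = b' then (if W \<and> \<not> a then x else 1) * body_weight W D l
     else if b \<noteq> b' \<and> W =
         a then (if \<not> a \<and> b then x else 1) * body_weight (\<not> W) D l else 0)"
| "body_weight _ _ _ = 0"
end

context fixes x w :: real begin
text \<open>Closed form of \<open>body_weight\<close> summed over removals of black corners: an
  outer pair \<open>True, False\<close> is either kept or replaced by \<open>False, True\<close>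
  with weight \<open>w * step_sign\<close>.\<close>

fun black_body_weight :: "bool \<Rightarrow> bool list \<Rightarrow> bool list \<Rightarrow> real"
    where
  "black_body_weight W [] [] = (if W then 0 else 1)"
| "black_body_weight W (a # a' # D) (b # b' # l) =
    (if a = b \<and> a = b' then (if W \<and> \<not> a then x else 1) * black_body_weight W D l
     else if b \<noteq> b' \<and> W =
         a then ((if \<not> a \<and> b then x else 1) +
         (if b then w * step_sign (False # l) else 0)) * black_body_weight (\<not> W) D l else 0)"
| "black_body_weight _ _ _ = 0"
end

lemma length_eq_two:
  assumes "length (a # b # D) = length l"
  obtains p q l' where "l = p # q # l'" "length D = length l'"
proof (cases l rule: remdups_adj.cases)
  case (3 p q l')
  then show ?thesis using assms that by simp
qed (use assms in auto)

lemma black_body_weight_eq: "length D = length l \<Longrightarrow>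
    word_sum (length D) (\<lambda>m. body_weight x W D m * black_kernel w False False m l) =
    black_body_weight x w W D l"
proof (induction D arbitrary: W l rule: paired.induct)
  case 1 then show ?case by simp
next
  case (2 y) then show ?case by (cases l) (auto simp: length_Suc_conv)
next
  case (3 a a' D)
  then obtain b b' l' where l: "l = b # b' # l'" and len: "length D = length l'"
    using length_eq_two[of a a' D l] by metis
  note IH = 3(1)[OF len]
  have IH1: "word_sum (length l') (\<lambda>m.
      x * body_weight x V D m * black_kernel w False False m l') =
      x * black_body_weight x w V D l'" for V
    using IH[of V] len word_sum_cmult[of "length l'" x "\<lambda>m.
        body_weight x V D m * black_kernel w False False m l'"] by (simp add: mult.assoc)
  have IH2: "word_sum (length l') (\<lambda>m.
      body_weight x V D m * (w * (e * black_kernel w False False m l'))) =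
      w * e * black_body_weight x w V D l'" for V e
    using IH[of V] len word_sum_cmult[of "length l'" "w * e" "\<lambda>m.
        body_weight x V D m * black_kernel w False False m l'"] by (simp add: ac_simps)
  show ?case using IH IH1 IH2 len unfolding l
    by (cases a; cases a'; cases b; cases b'; cases W) (simp_all add: distrib_right)
qed

section \<open>Comparison of the strip sum with the black corner sum\<close>

definition alt_sign :: "int \<Rightarrow> real" where "alt_sign b = (if even b then 1 else - 1)"

lemma alt_sign_simps: "alt_sign (b + 1) = - alt_sign b" "alt_sign (b - 1) =
    - alt_sign b" "alt_sign b * alt_sign b = 1" "alt_sign b * (alt_sign b * c) = c"
  by (auto simp: alt_sign_def)

text \<open>Here \<open>b\<close> is the number of white minus black strip squares met so far,
  \<open>B\<close> its final value, and \<open>\<tau>\<close> the sign of the total size, constant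
  along the words. A white opening puts a factor \<open>1 + alt_sign b * X\<close> on the left, a
  black closing puts \<open>1 - alt_sign b * X\<close> on the right. Both change \<open>b\<close>,
  and \<open>\<Phi>\<close> absorbs them.\<close>

lemma strip_kernel_body_black:
  assumes rec: "\<And>b. \<Phi> (b + 1) =
      \<tau> * (1 + alt_sign b * X) * \<Phi> b" and tt: "\<tau> * \<tau> = 1"
  shows "paired D \<Longrightarrow> length D = length l \<Longrightarrow>
      horiz_sign l = (if W then - 1 else 1) \<Longrightarrow>
      \<tau> = alt_sign b * area_sign l \<Longrightarrow>
      balance l = 2 * (B - b) + of_bool W \<Longrightarrow>
    \<Phi> b * strip_kernel X W (alt_sign b) D l =
        \<Phi> B * black_body_weight (- (X * X)) (- (\<tau> * X)) W D l"
proof (induction D arbitrary: W b l rule: paired.induct)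
  case 1 then show ?case by (cases W) auto
next
  case (2 y) then show ?case by simp
next
  case (3 a a' D)
  then obtain p q l' where l: "l = p # q # l'" and len: "length D = length l'"
    using length_eq_two[of a a' D l] by metis
  have aa: "a' = a" and D: "paired D" using 3 by auto
  note IH = 3(1)[OF D len]
  have IH1: "\<Phi> (b + 1) * strip_kernel X V (- alt_sign b) D l' =
      \<Phi> B * black_body_weight (- (X * X)) (- (\<tau> * X)) V D l'"
    if "horiz_sign l' = (if V then - 1 else 1)" "\<tau> =
        - (alt_sign b * area_sign l')" "balance l' = 2 * (B - (b + 1)) + of_bool V" for V
    using IH[of V "b + 1"] that by (simp add: alt_sign_simps)
  have IH2: "\<Phi> (b - 1) * strip_kernel X V (- alt_sign b) D l' =
      \<Phi> B * black_body_weight (- (X * X)) (- (\<tau> * X)) V D l'"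
    if "horiz_sign l' = (if V then - 1 else 1)" "\<tau> =
        - (alt_sign b * area_sign l')" "balance l' = 2 * (B - (b - 1)) + of_bool V" for V
    using IH[of V "b - 1"] that by (simp add: alt_sign_simps)
  have rec': "\<Phi> b = \<tau> * (1 - alt_sign b * X) * \<Phi> (b - 1)" using rec[of "b - 1"]
      by (simp add: alt_sign_simps)
  have horiz_sign: "horiz_sign l = (if W then - 1 else 1)" and area_sign: "\<tau> =
      alt_sign b * area_sign l" and balance: "balance l = 2 * (B - b) + of_bool W"
    using 3 by auto
  \<comment> \<open>A component opens (\<open>start\<close>) or closes (\<open>end\<close>) at this
    pair; \<open>b\<close> marks the outer pair \<open>True, False\<close>, which has a square on
    the black diagonal inside it, and \<open>o\<close> the pair \<open>False, True\<close>.\<close>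
  consider (eq) "p = a" "q = a" | (start_o) "\<not> a" "\<not> W" "\<not> p" q | (start_b) "\<not>
      a" "\<not> W" p "\<not> q"
    | (end_o) a W "\<not> p" q | (end_b) a W p "\<not> q" | (zero) "p \<noteq> a \<or> q \<noteq>
        a" "\<not> (p \<noteq> q \<and> W = a)" by argo
  then show ?case
  proof cases
    case eq
    have "horiz_sign l' = (if W then - 1 else 1)" using horiz_sign eq unfolding l by (cases a) auto
    moreover have "\<tau> = alt_sign b * area_sign l'" using area_sign eq horiz_sign
        unfolding l by (cases a) (auto simp: horiz_sign_sq)
    moreover have "balance l' = 2 * (B - b) + of_bool W" using balance eq unfolding l
        by (cases a) auto
    ultimately have *: "\<Phi> b * strip_kernel X W (alt_sign b) D l' =
        \<Phi> B * black_body_weight (- (X * X)) (- (\<tau> * X)) W D l'" and c: "horiz_sign l' =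
        (if W then - 1 else 1)"
      using IH by auto
    \<comment> \<open>Two further squares in one row give \<open>- (X * X)\<close>, two further
      squares in one column give 1.\<close>
    have "strip_kernel X W (alt_sign b) (a # a # D) (a # a # l') =
        (if W \<and> \<not> a then - (X * X) else 1) * strip_kernel X W (alt_sign b) D l'"
      using c area_sign_sq[of l'] horiz_sign_sq[of l']
          by (cases a; cases W) (auto simp: step_sign_def algebra_simps area_sign_sq alt_sign_simps)
    then show ?thesis using * unfolding l aa eq by (cases a; cases W) auto
  next
    case start_o
    have c: "horiz_sign l' = - 1" using horiz_sign start_o unfolding l by auto
    have s: "\<tau> = - (alt_sign b * area_sign l')" using area_sign start_o c unfolding l by auto
    have "balance l' = 2 * (B - (b + 1)) + 1" using balance start_o unfolding l by auto
    then have "\<Phi> (b + 1) * strip_kernel X True (- alt_sign b) D l' =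
        \<Phi> B * black_body_weight (- (X * X)) (- (\<tau> * X)) True D l'"
        using IH1[of True] c s by simp
    moreover have "\<Phi> b * strip_kernel X W (alt_sign b) (a # a' # D) l =
        \<Phi> (b + 1) * strip_kernel X True (- alt_sign b) D l'"
      using start_o unfolding l aa rec s by (simp add: step_sign_def c algebra_simps alt_sign_simps)
    ultimately show ?thesis using start_o unfolding l aa by simp
  next
    case start_b
    have c: "horiz_sign l' = - 1" using horiz_sign start_b unfolding l by auto
    have s: "\<tau> = alt_sign b * area_sign l'" using area_sign start_b c unfolding l by auto
    have "balance l' = 2 * (B - b) + 1" using balance start_b unfolding l by auto
    then have "\<Phi> b * strip_kernel X True (alt_sign b) D l' =
        \<Phi> B * black_body_weight (- (X * X)) (- (\<tau> * X)) True D l'"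
        using IH[of True b] c s by simp
    \<comment> \<open>Matching this factor with the next one dictates the weights:
      \<open>- (X * X)\<close> for keeping the black corner, \<open>- (\<tau> * X)\<close> for
      removing it.\<close>
    moreover have "strip_kernel X W (alt_sign b) (a # a' # D) l =
        (- (X * X) - alt_sign b * X) * strip_kernel X True (alt_sign b) D l'"
      using start_b area_sign_sq[of l'] unfolding l aa
          by (simp add: step_sign_def c algebra_simps area_sign_sq)
    moreover have "black_body_weight (- (X * X)) (- (\<tau> * X)) W (a # a' # D) l =
        (- (X * X) - alt_sign b * X) * black_body_weight (- (X * X)) (- (\<tau> * X)) True D l'"
      using start_b unfolding l aa by (simp add: step_sign_def c s algebra_simps area_sign_sq)
    ultimately show ?thesis by (metis mult.left_commute)
  next
    case end_o
    have c: "horiz_sign l' = 1" using horiz_sign end_o unfolding l by auto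
    have s: "\<tau> = alt_sign b * area_sign l'" using area_sign end_o c unfolding l by auto
    have "balance l' = 2 * (B - b)" using balance end_o unfolding l by auto
    then have "\<Phi> b * strip_kernel X False (alt_sign b) D l' =
        \<Phi> B * black_body_weight (- (X * X)) (- (\<tau> * X)) False D l'"
        using IH[of False b] c s by simp
    then show ?thesis using end_o unfolding l aa by simp
  next
    case end_b
    have c: "horiz_sign l' = 1" using horiz_sign end_b unfolding l by auto
    have s: "\<tau> = - (alt_sign b * area_sign l')" using area_sign end_b c unfolding l by auto
    have "balance l' = 2 * (B - (b - 1))" using balance end_b unfolding l by auto
    then have 1: "\<Phi> (b - 1) * strip_kernel X False (- alt_sign b) D l' =
        \<Phi> B * black_body_weight (- (X * X)) (- (\<tau> * X)) False D l'"
        using IH2[of False] c s by simp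
    have 2: "strip_kernel X W (alt_sign b) (a # a' # D) l =
        \<tau> * strip_kernel X False (- alt_sign b) D l'"
      using end_b unfolding l aa by (simp add: step_sign_def c s)
    have 3: "black_body_weight (- (X * X)) (- (\<tau> * X)) W (a # a' # D) l =
        (1 - alt_sign b * X) * black_body_weight (- (X * X)) (- (\<tau> * X)) False D l'"
      using end_b unfolding l aa by (simp add: step_sign_def c s algebra_simps area_sign_sq)
    have "\<Phi> b * (\<tau> * strip_kernel X False (- alt_sign b) D l') =
        (\<tau> * \<tau>) * ((1 - alt_sign b * X) * (\<Phi> (b - 1) *
        strip_kernel X False (- alt_sign b) D l'))"
      unfolding rec' by (simp only: ac_simps)
    then show ?thesis unfolding 2 3 1 tt by (simp only: ac_simps mult_1_left)
  next
    case zero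
    then show ?thesis unfolding l aa by (cases a; cases p; cases q; cases W) auto
  qed
qed

text \<open>
  The solution of the recursion in \<open>strip_kernel_body_black\<close> with value 1 at 0.
\<close>

definition colour_ratio :: "real \<Rightarrow> real \<Rightarrow> int \<Rightarrow> real" where
  "colour_ratio \<tau> X b = (if even b then 1 else \<tau>) * ((1 +
      X) * (1 - X)) powi (b div 2) * (if even b then 1 else 1 + X)"

lemma colour_ratio_rec:
  assumes "\<tau> * \<tau> = 1" "X > 1"
  shows "colour_ratio \<tau> X (b + 1) = \<tau> * (1 + alt_sign b * X) * colour_ratio \<tau> X b"
proof (cases "even b")
  case True
  then show ?thesis by (simp add: colour_ratio_def alt_sign_def)
next
  case False
  then have "(b + 1) div 2 = b div 2 + 1" by presburger
  moreover have "(1 + X) * (1 - X) \<noteq> 0" using assms by simp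
  ultimately have "colour_ratio \<tau> X (b + 1) =
      ((1 + X) * (1 - X)) powi (b div 2) * ((1 + X) * (1 - X))"
    using False by (simp add: colour_ratio_def power_int_add_1)
  moreover have "\<tau> * (1 + alt_sign b * X) * colour_ratio \<tau> X b =
      (\<tau> * \<tau>) * (((1 + X) * (1 - X)) powi (b div 2) * ((1 + X) * (1 - X)))"
    using False by (simp add: colour_ratio_def alt_sign_def)
  ultimately show ?thesis using assms by simp
qed

text \<open>The strip sum vanishes because \<open>D\<close> has zero imbalance. On the support of
  \<open>imbalance N n\<close> the colour ratio is one nonzero constant, and the black corner sum
  then disappears since it acts as the identity.\<close>

lemma body_weight_imbalance:
  assumes N: "even N" "n < N" and D: "paired D" "length D = 2 * N" "area D > 0" and X: "X > 1"
  shows "word_sum (2 * N) (\<lambda>l. body_weight (- (X * X)) False D l * imbalance N n l) = 0"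
proof -
  define \<tau> :: real where "\<tau> = (-1) ^ n"
  define B :: int where "B = of_bool (odd n)"
  let ?x = "- (X * X)" and ?w = "- (\<tau> * X)"
  have tt: "\<tau> * \<tau> = 1" by (simp add: \<tau>_def flip: power_add)
  have "strip_kernel X False 1 D l * imbalance N n l =
      colour_ratio \<tau> X B * (black_body_weight ?x ?w False D l * imbalance N n l)"
      if "length l = 2 * N" for l
  proof (cases "imbalance N n l = 0")
    case False
    then have "horiz l = N" "area l = n" using imbalance_nz[of N n l] by auto
    moreover have "balance l = 2 * B" using imbalance_chess[OF N(1), of n] False
        by (auto simp: B_def)
    ultimately have "colour_ratio \<tau> X 0 * strip_kernel X False (alt_sign 0) D l =
        colour_ratio \<tau> X B * black_body_weight ?x ?w False D l"
      using that N D by (intro strip_kernel_body_black colour_ratio_rec tt X) (auto simp: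
          horiz_sign_def area_sign_def alt_sign_def \<tau>_def)
    then show ?thesis by (simp add: colour_ratio_def alt_sign_def)
  qed simp
  then have "word_sum (2 * N) (\<lambda>l. strip_kernel X False 1 D l * imbalance N n l) =
      word_sum (2 * N) (\<lambda>l. colour_ratio \<tau> X B * (black_body_weight ?x ?w False D l *
      imbalance N n l))"
    by (intro word_sum_cong) auto
  moreover have "word_sum (2 * N) (\<lambda>l. strip_kernel X False 1 D l * imbalance N n l) = 0"
    using strip_kernel_imbalance N D imbalance_paired by auto
  \<comment> \<open>The excess \<open>B\<close> is 0 or 1, so the ratio is 1 or
    \<open>\<tau> * (1 + X)\<close>.\<close>
  moreover have "colour_ratio \<tau> X B \<noteq> 0" using X
      by (auto simp: colour_ratio_def B_def \<tau>_def)
  ultimately have "word_sum (2 * N) (\<lambda>l.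
      black_body_weight ?x ?w False D l * imbalance N n l) = 0" by (simp add: word_sum_cmult)
  moreover have "word_sum (2 * N) (\<lambda>l.
      black_body_weight ?x ?w False D l * imbalance N n l) =
     word_sum (2 * N) (\<lambda>l. word_sum (2 * N) (\<lambda>m.
         body_weight ?x False D m * (black_kernel ?w False False m l * imbalance N n l)))"
  proof (rule word_sum_cong)
    fix l :: "bool list" assume "length l = 2 * N"
    then have "black_body_weight ?x ?w False D l =
        word_sum (2 * N) (\<lambda>m. body_weight ?x False D m * black_kernel ?w False False m l)"
      using black_body_weight_eq[of D l ?x False ?w] D by simp
    then show "black_body_weight ?x ?w False D l * imbalance N n l =
        word_sum (2 * N) (\<lambda>m. body_weight ?x False D m *
        (black_kernel ?w False False m l * imbalance N n l))"
      using word_sum_cmult[of "2 * N" "imbalance N n l" "\<lambda>m.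
          body_weight ?x False D m * black_kernel ?w False False m l"] by (simp add: ac_simps)
  qed
  moreover have "\<dots> = word_sum (2 * N) (\<lambda>m.
      body_weight ?x False D m * (of_bool (area m = n) * imbalance N n m))"
    by (subst word_sum_swap, rule word_sum_cong) (simp add: word_sum_cmult black_kernel_imbalance N)
  moreover have "\<dots> = word_sum (2 * N) (\<lambda>m.
      body_weight ?x False D m * imbalance N n m)"
    by (rule word_sum_cong) (use imbalance_nz[of N n] in force)
  ultimately show ?thesis by simp
qed

section \<open>Sign-imbalance by removal of corners\<close>

definition precedes :: "square \<Rightarrow> square \<Rightarrow> bool" where
  "precedes p q \<longleftrightarrow> fst p < fst q \<or> fst p = fst q \<and> snd p < snd q"

definition inversions :: "square set \<Rightarrow> (square \<Rightarrow> nat) \<Rightarrow> (square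
    \<times> square) set" where
  "inversions S T = {(p, q). p \<in> S \<and> q \<in> S \<and> precedes p q \<and> T q < T p}"

definition corners :: "square set \<Rightarrow> square set" where
  "corners S = {(r, c). (r, c) \<in> S \<and> (Suc r, c) \<notin> S \<and> (r, Suc c) \<notin> S}"

text \<open>A list sorted by \<open>precedes\<close> has no repetitions, so positions and squares
  correspond.\<close>

lemma card_inversions_list:
  assumes "sorted_wrt precedes xs"
  shows "card {(i, j). i < j \<and> j < length (map T xs) \<and> map T xs ! i > map T xs ! j} =
      card (inversions (set xs) T)"
proof (rule bij_betw_same_card)
  have lt: "precedes (xs ! i) (xs ! j)" if "i < j" "j < length xs" for i j
    using assms that by (simp add: sorted_wrt_iff_nth_less)
  have inj: "i = j" if "i < length xs" "j < length xs" "xs ! i = xs ! j" for i j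
    using lt[of i j] lt[of j i] that by (cases i j rule: linorder_cases) (auto simp: precedes_def)
  show "bij_betw (\<lambda>(i, j). (xs ! i, xs ! j)) {(i, j). i < j \<and>
      j < length (map T xs) \<and> map T xs ! i > map T xs ! j} (inversions (set xs) T)"
    unfolding bij_betw_def
  proof
    show "inj_on (\<lambda>(i, j). (xs ! i, xs ! j)) {(i, j). i < j \<and>
        j < length (map T xs) \<and> map T xs ! i > map T xs ! j}"
      by (auto simp: inj_on_def intro: inj)
    show "(\<lambda>(i, j). (xs ! i, xs ! j)) ` {(i, j). i < j \<and> j < length (map T xs) \<and>
        map T xs ! i > map T xs ! j} = inversions (set xs) T"
    proof (intro equalityI subsetI)
      fix z assume "z \<in> inversions (set xs) T"
      then obtain i j where ij: "i < length xs" "j < length xs" "z =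
          (xs ! i, xs ! j)" "precedes (xs ! i) (xs ! j)" "T (xs ! j) < T (xs ! i)"
        by (auto simp: inversions_def in_set_conv_nth)
      then have "i < j" using lt[of j i]
          by (cases i j rule: linorder_cases) (auto simp: precedes_def)
      then have "(i, j) \<in> {(i, j). i < j \<and> j < length (map T xs) \<and>
          map T xs ! i > map T xs ! j}" using ij by simp
      then show "z \<in> (\<lambda>(i, j). (xs ! i, xs ! j)) ` {(i, j). i < j \<and>
          j < length (map T xs) \<and> map T xs ! i > map T xs ! j}"
        unfolding ij(3) by (rule rev_image_eqI) simp
    next
      fix z assume "z \<in> (\<lambda>(i, j). (xs ! i, xs ! j)) ` {(i, j). i < j \<and>
          j < length (map T xs) \<and> map T xs ! i > map T xs ! j}"
      then obtain i j where ij: "i < j" "j < length xs" "T (xs ! j) < T (xs ! i)" "z =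
          (xs ! i, xs ! j)" by auto
      then show "z \<in> inversions (set xs) T" using lt[of i j] by (simp add: inversions_def)
    qed
  qed
qed

lemma shape_finite: "is_shape S \<Longrightarrow> finite S"
  unfolding is_shape_iff by blast

lemma shape_ge1: "is_shape S \<Longrightarrow> (r, c) \<in> S \<Longrightarrow>
    1 \<le> r \<and> 1 \<le> c"
  unfolding is_shape_iff by blast

lemma shape_down: "is_shape S \<Longrightarrow> (r, c) \<in> S \<Longrightarrow>
    1 \<le> r' \<Longrightarrow> r' \<le> r \<Longrightarrow> 1 \<le> c' \<Longrightarrow>
    c' \<le> c \<Longrightarrow> (r', c') \<in> S"
  unfolding is_shape_iff by blast

lemma sorted_wrt_row_lists:
  "sorted_wrt precedes (concat (map (\<lambda>r. map (Pair r) [1..<Suc (f r)]) [a..<b]))"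
proof (induction b)
  case (Suc b)
  have "sorted_wrt precedes (map (Pair b) [1..<Suc k])" for k
    by (simp add: sorted_wrt_map precedes_def del: upt_Suc)
  moreover have "precedes p q" if "p \<in>
      set (concat (map (\<lambda>r. map (Pair r) [1..<Suc (f r)]) [a..<b]))" "q \<in>
      set (map (Pair b) [1..<Suc (f b)])" for p q
    using that by (auto simp: precedes_def simp del: upt_Suc)
  ultimately show ?case using Suc by (simp add: sorted_wrt_append upt_Suc[of a] del: upt_Suc)
qed simp

lemma sgn_tableau_inversions:
  assumes "is_shape S"
  shows "sgn_tableau S T = (- 1) ^ card (inversions S T)"
proof -
  define xs where "xs = concat (map (\<lambda>r.
      map (Pair r) [1..<Suc (part S r)]) [1..<Suc (card (fst ` S))])"
  have rows: "fst ` S = {1..card (fst ` S)}"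
  proof (rule initial_segment)
    show "finite (fst ` S)" using assms shape_finite by blast
    fix a b assume "a \<in> fst ` S" "1 \<le> b" "b \<le> a"
    then obtain c where "(a, c) \<in> S" by auto
    then have "(b, c) \<in> S" using shape_down[OF assms, of a c b c] shape_ge1[OF assms, of a c]
        \<open>1 \<le> b\<close> \<open>b \<le> a\<close> by simp
    then show "b \<in> fst ` S" by (rule rev_image_eqI) simp
  next
    fix a assume "a \<in> fst ` S"
    then obtain c where "(a, c) \<in> S" by auto
    then show "1 \<le> a" using shape_ge1[OF assms] by blast
  qed
  have "set xs = {(r, c). r \<in> fst ` S \<and> 1 \<le> c \<and> c \<le> part S r}"
    by (subst rows) (auto simp: xs_def image_iff simp del: upt_Suc)
  also have "\<dots> = S"
  proof (rule set_eqI, clarify)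
    fix r c
    have "r \<in> fst ` S" if "(r, c) \<in> S" using that by (rule rev_image_eqI) simp
    then show "(r, c) \<in> {(r, c). r \<in> fst ` S \<and> 1 \<le> c \<and>
        c \<le> part S r} \<longleftrightarrow> (r, c) \<in> S"
      using shape_mem_iff[OF assms, of r c] by blast
  qed
  finally have "set xs = S" .
  moreover have "reading_word S T = map T xs"
    by (simp add: reading_word_def xs_def map_concat comp_def del: upt_Suc)
  moreover have "sorted_wrt precedes xs" unfolding xs_def by (rule sorted_wrt_row_lists)
  ultimately show ?thesis using card_inversions_list[of xs T]
    by (simp add: sgn_tableau_def word_sign_def)
qed

lemma sign_imbalance_empty: "sign_imbalance {} = 1"
proof -
  have "SYT {} = {\<lambda>_. undefined}" by (auto simp: SYT_def bij_betw_def)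
  moreover have "is_shape {}" by (simp add: is_shape_iff)
  ultimately show ?thesis by (simp add: sign_imbalance_def sgn_tableau_inversions inversions_def)
qed

lemma shape_remove_corner:
  assumes S: "is_shape S" and p: "p \<in> corners S"
  shows "is_shape (S - {p})"
proof -
  obtain r c where rc: "p = (r, c)" "(r, c) \<in> S" "(Suc r, c) \<notin> S" "(r, Suc c) \<notin> S"
    using p by (auto simp: corners_def)
  have "(r', c') \<noteq> (r, c)"
      if "(r2, c2) \<in> S" "(r2, c2) \<noteq> (r, c)" "r' \<le> r2" "c' \<le> c2" for r' c' r2 c2
  proof
    assume eq: "(r', c') = (r, c)"
    then have "r < r2 \<or> c < c2" using that by auto
    then show False
      using shape_down[OF S that(1), of "Suc r" c] shape_down[OF S that(1), of r "Suc c"] rc that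
          eq shape_ge1[OF S rc(2)] by auto
  qed
  then show ?thesis using S unfolding rc(1) is_shape_iff[of "S - {(r, c)}"]
    by (auto simp: shape_finite intro: shape_down dest: shape_ge1)
qed

lemma SYT_finite: "finite S \<Longrightarrow> finite (SYT S)"
proof (rule finite_subset)
  assume "finite S"
  then show "finite (PiE S (\<lambda>_. {1..card S}))" by (intro finite_PiE) auto
  show "SYT S \<subseteq> PiE S (\<lambda>_. {1..card S})"
      by (auto simp: SYT_def bij_betw_def PiE_def)
qed

lemma corner_max:
  assumes S: "is_shape S" and p: "(r, c) \<in> corners S" and q: "(r', c') \<in>
      S" "r \<le> r'" "c \<le> c'"
  shows "r' = r \<and> c' = c"
proof (rule ccontr)
  assume "\<not> (r' = r \<and> c' = c)"
  then have "r < r' \<or> c < c'" using q by auto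
  then show False
    using shape_down[OF S q(1), of "Suc r" c] shape_down[OF S q(1), of r "Suc c"] p q shape_ge1[OF
        S, of r c]
    by (auto simp: corners_def)
qed

lemma SYT_extend:
  assumes S: "is_shape S" and p: "p \<in> corners S" and T: "T \<in> SYT (S - {p})"
  shows "T(p := card S) \<in> SYT S"
proof -
  obtain r c where rc: "p = (r, c)" by (cases p)
  have pS: "p \<in> S" and fin: "finite S" using p S by (auto simp: corners_def shape_finite)
  have n: "card S = Suc (card (S - {p}))" using fin pS by (metis card_Suc_Diff1)
  have b: "bij_betw T (S - {p}) {1..card (S - {p})}" and ext: "T \<in> extensional (S - {p})"
    and R: "\<And>r c c'. (r, c) \<in> S - {p} \<Longrightarrow>
        (r, c') \<in> S - {p} \<Longrightarrow> c < c' \<Longrightarrow> T (r, c) < T (r, c')"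
    and C: "\<And>r r' c. (r, c) \<in> S - {p} \<Longrightarrow>
        (r', c) \<in> S - {p} \<Longrightarrow> r < r' \<Longrightarrow> T (r, c) < T (r', c)"
    using T unfolding SYT_def by blast+
  have le: "T q < card S" if "q \<in> S - {p}" for q
    using b that n unfolding bij_betw_def by (metis atLeastAtMost_iff imageI le_imp_less_Suc)
  have "bij_betw (T(p := card S)) (S - {p}) {1..card (S - {p})}"
    by (rule bij_betw_cong[THEN iffD1, OF _ b]) auto
  then have "bij_betw (T(p := card S)) (S - {p} \<union> {p}) ({1..card (S - {p})} \<union>
      {(T(p := card S)) p})"
    by (rule notIn_Un_bij_betw[rotated 2]) (use n in auto)
  moreover have "S - {p} \<union> {p} = S" using pS by auto
  moreover have "{1..card (S - {p})} \<union> {(T(p := card S)) p} = {1..card S}"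
      unfolding n by auto
  ultimately have "bij_betw (T(p := card S)) S {1..card S}" by simp
  moreover have "T(p := card S) \<in> extensional S" using ext pS by (auto simp: extensional_def)
  moreover have "(T(p := card S)) (i, j) < (T(p := card S)) (i, j')"
      if "(i, j) \<in> S" "(i, j') \<in> S" "j < j'" for i j j'
    using that R[of i j j'] le[of "(i, j)"] corner_max[OF S p[unfolded rc], of i j']
        unfolding rc by auto
  moreover have "(T(p := card S)) (i, j) < (T(p := card S)) (i', j)"
      if "(i, j) \<in> S" "(i', j) \<in> S" "i < i'" for i i' j
    using that C[of i j i'] le[of "(i, j)"] corner_max[OF S p[unfolded rc], of i' j]
        unfolding rc by auto
  ultimately show ?thesis unfolding SYT_def by blast
qed

lemma SYT_restrict:
  assumes S: "is_shape S" and T: "T \<in> SYT S" and p: "p \<in> S" "T p = card S"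
  shows "p \<in> corners S" "T(p := undefined) \<in> SYT (S - {p})"
proof -
  obtain r c where rc: "p = (r, c)" by (cases p)
  have fin: "finite S" using S by (rule shape_finite)
  have n: "card S = Suc (card (S - {p}))" using fin p by (metis card_Suc_Diff1)
  have b: "bij_betw T S {1..card S}" and ext: "T \<in> extensional S"
    and R: "\<And>r c c'. (r, c) \<in> S \<Longrightarrow> (r, c') \<in> S \<Longrightarrow>
        c < c' \<Longrightarrow> T (r, c) < T (r, c')"
    and C: "\<And>r r' c. (r, c) \<in> S \<Longrightarrow> (r', c) \<in> S \<Longrightarrow>
        r < r' \<Longrightarrow> T (r, c) < T (r', c)"
    using T unfolding SYT_def by blast+
  have le: "T q \<le> card S" if "q \<in> S" for q
    using b that unfolding bij_betw_def by (metis atLeastAtMost_iff imageI)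
  show "p \<in> corners S"
    using R[of r c "Suc c"] C[of r c "Suc r"] le[of "(r, Suc c)"] le[of "(Suc r, c)"] p
        unfolding rc corners_def by auto
  have "bij_betw T (S - {p}) ({1..card S} - {T p})"
  proof (rule bij_betw_DiffI[OF b])
    show "{T p} \<subseteq> {1..card S}" using b p unfolding bij_betw_def by blast
  qed (use p in auto)
  moreover have "{1..card S} - {T p} = {1..card (S - {p})}" unfolding p(2) n by auto
  ultimately have b': "bij_betw T (S - {p}) {1..card (S - {p})}" by simp
  have "bij_betw (T(p := undefined)) (S - {p}) {1..card (S - {p})}"
    by (rule bij_betw_cong[THEN iffD1, OF _ b']) auto
  moreover have "T(p := undefined) \<in> extensional (S - {p})" using ext
      by (auto simp: extensional_def)
  ultimately show "T(p := undefined) \<in> SYT (S - {p})" unfolding SYT_def by (simp add: R C)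
qed

text \<open>A largest entry at \<open>p\<close> is inverted exactly with the squares read after
  \<open>p\<close>.\<close>

lemma inversions_extend:
  assumes "finite S" "p \<in> S" "\<And>q. q \<in> S - {p} \<Longrightarrow> T q < k"
  shows "card (inversions S (T(p := k))) =
      card (inversions (S - {p}) T) + card {q \<in> S. precedes p q}"
proof -
  have "inversions S (T(p := k)) =
      inversions (S - {p}) T \<union> Pair p ` {q \<in> S. precedes p q}"
  proof -
    have "(a, b) \<in> inversions S (T(p := k)) \<longleftrightarrow>
        (a, b) \<in> inversions (S - {p}) T \<union> Pair p ` {q \<in> S. precedes p q}" for a b
    proof (cases "a = p")
      case True
      have "T b < k" if "b \<in> S" "b \<noteq> p" using assms(3)[of b] that by simp
      moreover have "\<not> precedes p p" by (simp add: precedes_def)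
      ultimately show ?thesis using assms(2) True unfolding inversions_def by (cases "b = p") auto
    next
      case False
      then show ?thesis using assms(3)[of a] unfolding inversions_def by (cases "b = p") auto
    qed
    then show ?thesis unfolding set_eq_iff split_paired_All[of "\<lambda>z. (z \<in> _) =
        (z \<in> _)"] by blast
  qed
  moreover have "finite (inversions (S - {p}) T)"
    by (rule finite_subset[of _ "S \<times> S"]) (use assms(1) in \<open>auto simp:
        inversions_def\<close>)
  moreover have "inversions (S - {p}) T \<inter> Pair p ` {q \<in> S. precedes p q} = {}"
      by (auto simp: inversions_def)
  moreover have "card (Pair p ` {q \<in> S. precedes p q}) = card {q \<in> S. precedes p q}"
    by (rule card_image) (simp add: inj_on_def)
  moreover have "finite (Pair p ` {q \<in> S. precedes p q})" using assms(1) by simp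
  ultimately show ?thesis by (simp only: card_Un_disjoint)
qed

lemma sign_imbalance_corners:
  assumes S: "is_shape S" "S \<noteq> {}"
  shows "sign_imbalance S = (\<Sum>p\<in>corners S. (- 1) ^ card {q \<in>
      S. precedes p q} * sign_imbalance (S - {p}))"
proof -
  have fin: "finite S" using S by (simp add: shape_finite)
  have cS: "corners S \<subseteq> S" by (auto simp: corners_def)
  have fS: "finite (corners S)" using fin cS finite_subset by blast
  define ext where "ext p T = T(p := card S)" for p :: square and T :: "square \<Rightarrow> nat"
  have SYT_undef: "T p = undefined" if "T \<in> SYT (S - {p})" for T p
    using that unfolding SYT_def extensional_def by blast
  have SYT_less: "T q < card S" if "p \<in> S" "T \<in> SYT (S - {p})" "q \<in> S - {p}" for T p q
  proof -
    have "T q \<in> {1..card (S - {p})}" using that by (auto simp: SYT_def bij_betw_def)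
    moreover have "card (S - {p}) < card S" using fin that by (meson card_Diff1_less)
    ultimately show ?thesis by simp
  qed
  have U: "SYT S = (\<Union>p\<in>corners S. ext p ` SYT (S - {p}))"
  proof (intro equalityI subsetI)
    fix T assume T: "T \<in> SYT S"
    have "card S \<in> {1..card S}" using fin S by (simp add: Suc_leI card_gt_0_iff)
    moreover have "T ` S = {1..card S}" using T unfolding SYT_def bij_betw_def by blast
    ultimately obtain p where p: "p \<in> S" "T p = card S" by (metis imageE)
    have "T = ext p (T(p := undefined))" using p by (auto simp: ext_def)
    then show "T \<in> (\<Union>p\<in>corners S. ext p ` SYT (S - {p}))"
        using SYT_restrict[OF S(1) T p] by blast
  next
    fix T assume "T \<in> (\<Union>p\<in>corners S. ext p ` SYT (S - {p}))"
    then show "T \<in> SYT S" using SYT_extend[OF S(1)] by (auto simp: ext_def)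
  qed
  have inj: "inj_on (ext p) (SYT (S - {p}))" for p
  proof (rule inj_onI)
    fix T T' assume a: "T \<in> SYT (S - {p})" "T' \<in> SYT (S - {p})" "ext p T = ext p T'"
    have "T q = T' q" for q
    proof (cases "q = p")
      case False
      then show ?thesis using fun_cong[OF a(3), of q] by (simp add: ext_def)
    qed (use SYT_undef[OF a(1)] SYT_undef[OF a(2)] in simp)
    then show "T = T'" by auto
  qed
  have dis: "ext p ` SYT (S - {p}) \<inter> ext q ` SYT (S - {q}) = {}"
      if "p \<in> corners S" "q \<in> corners S" "p \<noteq> q" for p q
  proof -
    have "ext p T \<noteq> ext q T'" if "T \<in> SYT (S - {p})" "T' \<in> SYT (S - {q})" for T T'
    proof
      assume "ext p T = ext q T'"
      then have "ext q T' p = card S" by (metis ext_def fun_upd_same)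
      moreover have "ext q T' p = T' p" using \<open>p \<noteq> q\<close> by (simp add: ext_def)
      moreover have "T' p < card S" using SYT_less[of q T' p] that cS \<open>p \<in>
          corners S\<close> \<open>q \<in> corners S\<close> \<open>p \<noteq> q\<close> by auto
      ultimately show False by simp
    qed
    then show ?thesis by blast
  qed
  have "sign_imbalance S = (\<Sum>p\<in>corners S. \<Sum>T\<in>ext p ` SYT (S - {p}).
      sgn_tableau S T)"
    unfolding sign_imbalance_def U
    by (rule sum.UNION_disjoint) (use fS fin SYT_finite dis in auto)
  also have "\<dots> = (\<Sum>p\<in>corners S. (- 1) ^ card {q \<in>
      S. precedes p q} * sign_imbalance (S - {p}))"
  proof (rule sum.cong)
    fix p assume p: "p \<in> corners S"
    have "(\<Sum>T\<in>ext p ` SYT (S - {p}). sgn_tableau S T) =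
        (\<Sum>T\<in>SYT (S - {p}). sgn_tableau S (ext p T))"
      by (simp add: sum.reindex inj)
    also have "\<dots> = (\<Sum>T\<in>SYT (S - {p}). (- 1) ^ card {q \<in>
        S. precedes p q} * sgn_tableau (S - {p}) T)"
    proof (rule sum.cong)
      fix T assume "T \<in> SYT (S - {p})"
      then have "card (inversions S (ext p T)) =
          card (inversions (S - {p}) T) + card {q \<in> S. precedes p q}"
        unfolding ext_def using fin p cS SYT_less[of p T] by (intro inversions_extend) auto
      then show "sgn_tableau S (ext p T) =
          (- 1) ^ card {q \<in> S. precedes p q} * sgn_tableau (S - {p}) T"
        by (simp add: sgn_tableau_inversions S shape_remove_corner p power_add)
    qed simp
    finally show "(\<Sum>T\<in>ext p ` SYT (S - {p}). sgn_tableau S T) =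
        (- 1) ^ card {q \<in> S. precedes p q} * sign_imbalance (S - {p})"
      by (simp add: sign_imbalance_def sum_distrib_left)
  qed simp
  finally show ?thesis .
qed

section \<open>Shapes and boundary words\<close>

text \<open>Vertical steps with no horizontal step behind them give zero parts, so all words of one
  box have equally many rows.\<close>

primrec rows :: "bool list \<Rightarrow> nat list" where
  "rows [] = []" | "rows (b # l) = (if b then horiz l # rows l else rows l)"

lemma rows_le: "a \<in> set (rows l) \<Longrightarrow> a \<le> horiz l"
  by (induction l) (auto split: if_splits)

lemma rows_sorted: "sorted_wrt (\<ge>) (rows l)"
  by (induction l) (auto dest: rows_le)

lemma length_rows: "length (rows l) + horiz l = length l"
  by (induction l) auto

lemma sum_rows: "sum_list (rows l) = area l"
  by (induction l) auto

lemma rows_exist: "sorted_wrt (\<ge>) R \<Longrightarrow>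
    \<forall>a\<in>set R. a \<le> k \<Longrightarrow> \<exists>l. rows l = R \<and> horiz l = k"
proof (induction R arbitrary: k)
  case Nil
  have "rows (replicate k False) = []" by (induction k) auto
  then show ?case by (intro exI[of _ "replicate k False"]) simp
next
  case (Cons a R)
  then obtain l where l: "rows l = R" "horiz l = a" by fastforce
  have "rows (replicate j False @ True # l) = a # R" for j using l by (induction j) auto
  then show ?case using l Cons.prems by (intro exI[of _ "replicate (k - a) False @ True # l"]) simp
qed

lemma rows_inj: "rows l = rows l' \<Longrightarrow> horiz l = horiz l' \<Longrightarrow> l = l'"
proof (induction l arbitrary: l')
  case Nil
  then show ?case by (cases l') (auto split: if_splits)
next
  case (Cons b l)
  show ?case
  proof (cases l')
    case Nil
    then show ?thesis using Cons.prems by (auto split: if_splits)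
  next
    case l': (Cons b' t)
    have "b = b'"
    proof (rule ccontr)
      assume "b \<noteq> b'"
      then consider "b" "\<not> b'" | "\<not> b" "b'" by auto
      then show False
      proof cases
        case 1
        then have "horiz l \<in> set (rows t)" using Cons.prems(1) l'
            by (metis list.set_intros(1) rows.simps(2))
        then show False using 1 Cons.prems(2) l' rows_le[of "horiz l" t] by simp
      next
        case 2
        then have "horiz t \<in> set (rows l)" using Cons.prems(1) l'
            by (metis list.set_intros(1) rows.simps(2))
        then show False using 2 Cons.prems(2) l' rows_le[of "horiz t" l] by simp
      qed
    qed
    then show ?thesis using Cons l' by (auto split: if_splits)
  qed
qed

section \<open>Ferrers diagrams row by row\<close>

definition shift_down :: "square \<Rightarrow> square" where "shift_down p = (Suc (fst p), snd p)"

lemma shift_down_simps: "shift_down (r, c) =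
    (Suc r, c)" "inj shift_down" "(Suc r, c) \<in> shift_down ` A \<longleftrightarrow>
    (r, c) \<in> A" "(0, c) \<notin> shift_down ` A"
  by (auto simp: shift_down_def inj_on_def prod_eq_iff image_iff Bex_def)

lemma ferrers_Nil [simp]: "ferrers [] = {}"
  by (auto simp: ferrers_def)

lemma ferrers_Cons_mem:
  "(0, c) \<notin> ferrers R" "(Suc 0, c) \<in> ferrers (a # R) \<longleftrightarrow>
      1 \<le> c \<and> c \<le> a"
  "(Suc (Suc r), c) \<in> ferrers (a # R) \<longleftrightarrow> (Suc r, c) \<in> ferrers R"
  by (auto simp: ferrers_def)

lemma ferrers_Cons: "ferrers (a # R) = Pair 1 ` {1..a} \<union> shift_down ` ferrers R"
proof -
  have "(r, c) \<in> ferrers (a # R) \<longleftrightarrow>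
      (r, c) \<in> Pair 1 ` {1..a} \<union> shift_down ` ferrers R" for r c
  proof (cases r)
    case 0
    then show ?thesis by (auto simp: ferrers_Cons_mem shift_down_simps)
  next
    case r: (Suc r')
    show ?thesis
    proof (cases r')
      case 0
      then show ?thesis using r by (auto simp: ferrers_Cons_mem shift_down_simps)
    next
      case (Suc k)
      then show ?thesis using r by (auto simp: ferrers_Cons_mem shift_down_simps)
    qed
  qed
  then show ?thesis by auto
qed

lemma ferrers_finite: "finite (ferrers R)"
  by (induction R) (auto simp: ferrers_Cons)

lemma ferrers_row_disjoint: "Pair 1 ` A \<inter> shift_down ` ferrers R = {}"
  using ferrers_Cons_mem(1) by (auto simp: shift_down_def)

lemma ferrers_card: "card (ferrers R) = sum_list R"
proof (induction R)
  case (Cons a R)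
  have "card (ferrers (a # R)) = card (Pair (1::nat) ` {1..a}) + card (shift_down ` ferrers R)"
    unfolding ferrers_Cons by (rule card_Un_disjoint) (simp_all only: ferrers_row_disjoint
        finite_imageI ferrers_finite finite_atLeastAtMost)
  moreover have "card (shift_down ` ferrers R) = card (ferrers R)"
    by (rule card_image) (rule inj_on_subset[OF shift_down_simps(2)], simp)
  ultimately show ?case using Cons by (simp add: card_image inj_on_def)
qed simp

lemma ferrers_shape: assumes "sorted_wrt (\<ge>) R" shows "is_shape (ferrers R)"
proof -
  have "R ! (r - 1) \<le> R ! (r' - 1)" if "1 \<le> r'" "r' \<le> r" "r \<le> length R" for r r'
    using assms that sorted_wrt_nth_less[of "(\<ge>)" R "r' - 1" "r - 1"] by (cases "r = r'") auto
  then have "(r', c') \<in> ferrers R"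
      if "(r, c) \<in> ferrers R" "1 \<le> r'" "r' \<le> r" "1 \<le> c'" "c' \<le> c" for r c r' c'
    using that by (fastforce simp: ferrers_def)
  moreover have "1 \<le> r \<and> 1 \<le> c" if "(r, c) \<in> ferrers R" for r c using that
      by (auto simp: ferrers_def)
  ultimately show ?thesis unfolding is_shape_iff using ferrers_finite by blast
qed

text \<open>Diagrams do not show zero parts; the equal lengths recover them.\<close>

lemma ferrers_inj: assumes "ferrers R = ferrers R'" "length R = length R'" shows "R = R'"
proof (rule nth_equalityI)
  fix i assume i: "i < length R"
  have "{c. (Suc i, c) \<in> ferrers R} = {1..R ! i}" "{c. (Suc i, c) \<in> ferrers R'} =
      {1..R' ! i}"
    using i assms(2) by (auto simp: ferrers_def)
  then have "{1..R ! i} = {1..R' ! i}" using assms(1) by (simp only:)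
  then show "R ! i = R' ! i" by (metis card_atLeastAtMost diff_Suc_1)
qed (use assms in simp)

lemma corners_Cons:
  assumes "\<forall>b\<in>set R. b \<le> a"
  shows "corners (ferrers (a # R)) =
    (if 1 \<le> a \<and> (R = [] \<or> hd R < a) then
        {(1, a)} else {}) \<union> shift_down ` corners (ferrers R)"
proof -
  have one: "(Suc 0, c) \<in> ferrers R \<longleftrightarrow>
      R \<noteq> [] \<and> 1 \<le> c \<and> c \<le> hd R" for c
    by (cases R) (auto simp: ferrers_Cons_mem)
  have hd: "hd R \<le> a" if "R \<noteq> []" using assms that by (cases R) auto
  have "(r, c) \<in> corners (ferrers (a # R)) \<longleftrightarrow>
      (r, c) \<in> (if 1 \<le> a \<and> (R =
      [] \<or> hd R < a) then {(1, a)} else {}) \<union> shift_down ` corners (ferrers R)" for r c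
  proof (cases r)
    case 0
    then show ?thesis by (auto simp: corners_def ferrers_Cons_mem shift_down_simps)
  next
    case r: (Suc r')
    show ?thesis
    proof (cases r')
      case 0
      have "(Suc 0, c) \<in> corners (ferrers (a # R)) \<longleftrightarrow>
          1 \<le> c \<and> c \<le> a \<and> \<not> (R \<noteq> [] \<and> 1 \<le> c \<and>
          c \<le> hd R) \<and> \<not> Suc c \<le> a"
        by (auto simp: corners_def ferrers_Cons_mem one)
      moreover have "(Suc 0, c) \<notin> shift_down ` corners (ferrers R)"
          by (simp add: shift_down_simps corners_def ferrers_Cons_mem)
      ultimately show ?thesis using r 0 hd by (cases "R = []") auto
    next
      case (Suc k)
      then show ?thesis using r by (simp add: corners_def ferrers_Cons_mem shift_down_simps)
    qed
  qed
  then show ?thesis by auto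
qed

lemma precedes_shift_down: "precedes (shift_down p) (shift_down q) \<longleftrightarrow>
    precedes p q"
  by (simp add: precedes_def shift_down_def)

lemma card_after_shift_down:
  assumes "p \<in> ferrers R"
  shows "card {q \<in> ferrers (a # R). precedes (shift_down p) q} =
      card {q \<in> ferrers R. precedes p q}"
proof -
  have "\<not> precedes (shift_down p) (1, c)" for c using assms
      by (cases p) (auto simp: precedes_def shift_down_def ferrers_def)
  then have "{q \<in> ferrers (a # R). precedes (shift_down p) q} =
      shift_down ` {q \<in> ferrers R. precedes p q}"
    unfolding ferrers_Cons by (auto simp: precedes_shift_down)
  then show ?thesis by (simp add: card_image inj_on_subset[OF shift_down_simps(2)])
qed

lemma card_after_first_row: "card {q \<in> ferrers (a # R). precedes (1, a) q} = sum_list R"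
proof -
  have "precedes (1, a) (shift_down q)" if "q \<in> ferrers R" for q using that
      by (cases q) (auto simp: precedes_def shift_down_def ferrers_def)
  moreover have "\<not> precedes (1, a) (1, c)" if "c \<in> {1..a}" for c using that
      by (auto simp: precedes_def)
  ultimately have "{q \<in> ferrers (a # R). precedes (1, a) q} = shift_down ` ferrers R"
    unfolding ferrers_Cons by auto
  then show ?thesis by (simp add: card_image inj_on_subset[OF shift_down_simps(2)] ferrers_card)
qed

text \<open>A leading vertical step adds a top row, absorbed into the arbitrary \<open>g\<close>. It
  ends in a corner iff the next letter is horizontal, and all lower rows are read after that
  corner.\<close>

lemma corner_sum_corners:
  "corner_sum (\<lambda>t. g (ferrers (rows t))) l = (\<Sum>p\<in>corners (ferrers (rows l)).
     (- 1) ^ card {q \<in> ferrers (rows l). precedes p q} * g (ferrers (rows l) - {p}))"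
proof (induction l arbitrary: g)
  case Nil
  then show ?case by (simp add: corners_def)
next
  case (Cons b l)
  show ?case
  proof (cases b)
    case False
    then show ?thesis using Cons[of g] by (simp add: corner_sum_Cons)
  next
    case True
    let ?R = "rows l" and ?a = "horiz l"
    let ?h = "l \<noteq> [] \<and> \<not> hd l"
    define w where "w p = (- 1) ^ card {q \<in>
        ferrers (?a # ?R). precedes p q} * g (ferrers (?a # ?R) - {p})" for p
    have fin: "finite (corners (ferrers ?R))"
        by (rule finite_subset[OF _ ferrers_finite[of ?R]]) (auto simp: corners_def)
    have "(1 \<le> ?a \<and> (?R = [] \<or> hd ?R < ?a)) = ?h"
    proof (cases l)
      case (Cons c s)
      have "hd (rows s) \<le> horiz s" if "rows s \<noteq> []"
          using rows_le[of "hd (rows s)" s] that by simp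
      then show ?thesis using Cons by (cases c) (auto simp: less_Suc_eq_le)
    qed simp
    then have cor: "corners (ferrers (?a # ?R)) =
        (if ?h then {(1, ?a)} else {}) \<union> shift_down ` corners (ferrers ?R)"
      using corners_Cons[of ?R ?a] rows_le[of _ l] by simp
    have "(1, ?a) \<notin> shift_down ` corners (ferrers ?R)"
        by (simp add: shift_down_simps(3) corners_def ferrers_Cons_mem(1) del: One_nat_def add:
        One_nat_def)
    then have "(\<Sum>p\<in>corners (ferrers (?a # ?R)). w p) =
        (if ?h then w (1, ?a) else 0) + (\<Sum>p\<in>shift_down ` corners (ferrers ?R). w p)"
      unfolding cor using fin by (auto simp: insert_is_Un[symmetric])
    also have "(\<Sum>p\<in>shift_down ` corners (ferrers ?R). w p) =
        (\<Sum>p\<in>corners (ferrers ?R). w (shift_down p))"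
      by (rule sum.reindex_cong[OF inj_on_subset[OF shift_down_simps(2)]]) auto
    also have "\<dots> = (\<Sum>p\<in>corners (ferrers ?R). (- 1) ^ card {q \<in>
        ferrers ?R. precedes p q} * g (Pair 1 ` {1..?a} \<union> shift_down ` (ferrers ?R - {p})))"
    proof (rule sum.cong)
      fix p assume "p \<in> corners (ferrers ?R)"
      then have p: "p \<in> ferrers ?R" by (auto simp: corners_def)
      have "shift_down p \<notin> Pair 1 ` {1..?a}"
          using p ferrers_row_disjoint[of "{1..?a}" ?R] by blast
      then have "ferrers (?a # ?R) - {shift_down p} =
          Pair 1 ` {1..?a} \<union> shift_down ` (ferrers ?R - {p})"
        unfolding ferrers_Cons image_set_diff[OF shift_down_simps(2)] by blast
      then show "w (shift_down p) = (- 1) ^ card {q \<in>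
          ferrers ?R. precedes p q} * g (Pair 1 ` {1..?a} \<union> shift_down ` (ferrers ?R - {p}))"
        by (simp add: w_def card_after_shift_down[OF p])
    qed simp
    also have "\<dots> = corner_sum (\<lambda>t. g (Pair 1 ` {1..?a} \<union>
        shift_down ` ferrers (rows t))) l"
      by (rule Cons[of "\<lambda>S. g (Pair 1 ` {1..?a} \<union> shift_down ` S)", symmetric])
    also have "\<dots> = corner_sum (\<lambda>t. g (ferrers (rows (True # t)))) l"
      by (rule corner_sum_cong_on) (simp add: ferrers_Cons)
    also have "(if ?h then w (1, ?a) else 0) =
        (if ?h then area_sign (tl l) * g (ferrers (rows (False # True # tl l))) else 0)"
    proof (cases ?h)
      case h: True
      then obtain s where s: "l = False # s" by (cases l) auto
      have "ferrers (?a # ?R) - {(1, ?a)} = ferrers (horiz s # rows s)"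
      proof -
        have "(1, ?a) \<notin> shift_down ` ferrers ?R"
            by (simp add: shift_down_simps(3) ferrers_Cons_mem(1))
        moreover have "Pair 1 ` {1..?a} - {(1, ?a)} = Pair (1::nat) ` {1..horiz s}"
            unfolding s by auto
        ultimately show ?thesis unfolding ferrers_Cons s by auto
      qed
      then show ?thesis using h card_after_first_row[of ?a ?R]
          by (simp add: w_def sum_rows s area_sign_def)
    qed auto
    finally show ?thesis using True by (simp add: corner_sum_Cons w_def)
  qed
qed

lemma sign_imbalance_word:
  "length l = 2 * N \<Longrightarrow> horiz l = N \<Longrightarrow>
      real_of_int (sign_imbalance (ferrers (rows l))) = imbalance N (area l) l"
proof (induction "area l" arbitrary: l)
  case 0
  then have "l = empty_word N" using area0_word[of l] by (simp add: empty_word_def)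
  moreover have "ferrers (rows l) = {}"
    using ferrers_card[of "rows l"] 0 ferrers_finite[of "rows l"] by (simp add: sum_rows)
  ultimately show ?case using 0 by (simp add: sign_imbalance_empty)
next
  case (Suc n)
  have "ferrers (rows l) \<noteq> {}" using ferrers_card[of "rows l"] Suc by (auto simp: sum_rows)
  then have "real_of_int (sign_imbalance (ferrers (rows l))) =
      corner_sum (\<lambda>t. real_of_int (sign_imbalance (ferrers (rows t)))) l"
    using sign_imbalance_corners[OF ferrers_shape[OF rows_sorted]] corner_sum_corners[of
        "\<lambda>S. real_of_int (sign_imbalance S)" l] by simp
  also have "\<dots> = corner_sum (imbalance N n) l"
  proof (rule corner_sum_cong_on)
    fix t assume "length t = length l" "horiz t = horiz l" "Suc (area t) = area l"
    then show "real_of_int (sign_imbalance (ferrers (rows t))) = imbalance N n t"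
      using Suc(1)[of t] Suc(2-4) by (metis nat.inject)
  qed
  finally show ?case using Suc(2) by (simp flip: Suc(2))
qed

lemma shape_rows:
  assumes S: "is_shape S" and N: "card S \<le> N"
  obtains l where "length l = 2 * N" "horiz l = N" "ferrers (rows l) = S"
proof -
  obtain lam where lam: "is_partition lam" "S = ferrers lam" using S by (auto simp: is_shape_def)
  have card: "card S = sum_list lam" using lam by (simp add: ferrers_card)
  have "length xs \<le> sum_list xs" if "0 \<notin> set xs" for xs :: "nat list"
    using that by (induction xs) (auto simp: Suc_le_eq add_less_le_mono intro: add_mono)
  then have len: "length lam \<le> N" using lam(1) N card by (fastforce simp: is_partition_def)
  let ?R = "lam @ replicate (N - length lam) 0"
  have "sorted_wrt (\<ge>) (replicate k (0::nat))" for k by (induction k) auto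
  then have "sorted_wrt (\<ge>) ?R" using lam(1) by (auto simp: is_partition_def sorted_wrt_append)
  moreover have "\<forall>a\<in>set ?R. a \<le> N"
      using member_le_sum_list[of _ lam] card N by fastforce
  ultimately obtain l where l: "rows l = ?R" "horiz l = N" using rows_exist by blast
  moreover have "length l = 2 * N" using length_rows[of l] l len by simp
  moreover have "ferrers ?R = ferrers lam" by (auto simp: ferrers_def nth_append split: if_splits)
  ultimately show ?thesis using that lam by simp
qed

lemma bij_words_shapes:
  assumes "n < N"
  shows "bij_betw (\<lambda>l. ferrers (rows l)) {l. length l = 2 * N \<and> horiz l =
      N \<and> area l = n} {S. is_shape S \<and> card S = n}"
  unfolding bij_betw_def
proof
  show "inj_on (\<lambda>l. ferrers (rows l)) {l. length l = 2 * N \<and> horiz l =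
      N \<and> area l = n}"
  proof (rule inj_onI, clarify)
    fix l l' assume a: "ferrers (rows l) = ferrers (rows l')" "length l =
        2 * horiz l" "length l' = 2 * horiz l" "horiz l' = horiz l"
    then have "rows l = rows l'" using length_rows[of l] length_rows[of l']
        by (intro ferrers_inj) auto
    then show "l = l'" using a by (intro rows_inj) auto
  qed
  show "(\<lambda>l. ferrers (rows l)) ` {l. length l = 2 * N \<and> horiz l = N \<and> area l =
      n} = {S. is_shape S \<and> card S = n}"
  proof (intro equalityI subsetI)
    fix S assume "S \<in> {S. is_shape S \<and> card S = n}"
    then obtain l where l: "length l = 2 * N" "horiz l = N" "ferrers (rows l) = S"
        using shape_rows[of S N] assms by auto
    then have "area l = n" using \<open>S \<in> _\<close> ferrers_card[of "rows l"]
        by (simp add: sum_rows)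
    then show "S \<in> (\<lambda>l. ferrers (rows l)) ` {l. length l = 2 * N \<and> horiz l =
        N \<and> area l = n}" using l by blast
  qed (auto simp: ferrers_shape rows_sorted ferrers_card sum_rows)
qed

section \<open>Fourling bodies and strips\<close>

text \<open>Complete fourlings in two consecutive rows reach as far as the even part of the shorter
  row.\<close>

fun body_rows :: "nat list \<Rightarrow> nat list" where
  "body_rows (a # b # R) = 2 * (b div 2) # 2 * (b div 2) # body_rows R" | "body_rows R = R"

text \<open>The number of strip squares in even columns: all lie in the longer row of a pair, since
  the shorter one exceeds the body by at most one square, in an odd column.\<close>

fun hs_rows :: "nat list \<Rightarrow> nat" where
  "hs_rows (a # b # R) = (a div 2 - b div 2) + hs_rows R" | "hs_rows _ = 0"

fun vs_rows :: "nat list \<Rightarrow> nat" where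
  "vs_rows (a # b # R) = b mod 2 + vs_rows R" | "vs_rows _ = 0"

text \<open>White minus black squares: a row counts only if its length is odd, with the colour of
  its first square.\<close>

primrec row_balance :: "nat list \<Rightarrow> int" where
  "row_balance [] = 0" | "row_balance (a # R) = int (a mod 2) - row_balance R"

lemma length_body_rows [simp]: "length (body_rows R) = length R"
    by (induction R rule: body_rows.induct) auto

lemma rows_balance:
  assumes "sorted_wrt (\<ge>) R" "even (length R)"
  shows "int (sum_list R) = int (sum_list (body_rows R)) + 2 * int (hs_rows R + vs_rows R) +
      row_balance R"
  using assms
proof (induction R rule: body_rows.induct)
  case (1 a b R)
  have "b div 2 \<le> a div 2" using 1 by (simp add: div_le_mono)
  moreover have "int k = 2 * int (k div 2) + int (k mod 2)" for k
    by (metis mult_div_mod_eq of_nat_add of_nat_mult of_nat_numeral)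
  note this[of a] this[of b]
  ultimately have "int (a + b) = 4 * int (b div 2) + 2 * int (a div 2 - b div 2 + b mod 2) +
      int (a mod 2) - int (b mod 2)"
    by (simp add: of_nat_diff)
  then show ?case using 1 by (simp del: of_nat_mod of_nat_div)
qed auto

lemma balance_rows: "even (length l) \<Longrightarrow>
    balance l = (if even (horiz l) then 2 * row_balance (rows l) else 1 - 2 * row_balance (rows l))"
proof (induction l rule: paired.induct)
  case (3 x y s)
  have "horiz s mod 2 = of_bool (odd (horiz s))" "Suc (horiz s) mod 2 =
      of_bool (even (horiz s))" by (simp_all add: mod_2_eq_odd)
  then show ?case using 3 by (cases x; cases y) (auto split: if_splits)
qed auto

lemma paired_rows_even: "paired D \<Longrightarrow> even (length (rows D))"
  by (induction D rule: paired.induct) auto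

text \<open>With \<open>W\<close> set the outer suffix starts inside a pair of rows. The open upper
  row is represented by its part of length \<open>horiz l\<close>, which makes the number of rows
  even again.\<close>

lemma body_weight_rows:
  assumes "paired D" "length D = length l" "horiz l = horiz D + of_bool W"
  shows "body_weight x W D l = (let R = (if W then horiz l # rows l else rows l) in if rows D =
      body_rows R then x ^ hs_rows R else 0)"
  using assms
proof (induction D arbitrary: W l rule: paired.induct)
  case 1 then show ?case by (cases W) auto
next
  case (2 y) then show ?case by simp
next
  case (3 a a' D)
  then obtain p q s where l: "l = p # q # s" and len: "length D = length s"
    using length_eq_two[of a a' D l] by metis
  have aa: "a' = a" and D: "paired D" using 3 by auto
  have ev: "even (horiz D)" using paired_even[OF D] by simp
  note IH = 3(1)[OF D len]
  have lenr: "length (rows s) + horiz s = length (rows D) + horiz D"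
      using length_rows[of s] length_rows[of D] len by simp
  have evr: "even (length (rows D))" by (rule paired_rows_even[OF D])
  have le: "\<forall>u\<in>set (rows s). u \<le> horiz s" "\<forall>u\<in>set (rows D).
      u \<le> horiz D" using rows_le by auto
  have horiz: "horiz l = horiz (a # a' # D) + of_bool W" using 3 by simp
  have ne: "body_rows (u # rows s) \<noteq> k # k # Q" if "horiz s < k" for u k Q
    using le(1) that by (cases "rows s") auto
  have ne1: "body_rows (rows s) \<noteq> k # k # Q" if "horiz s < k" for k Q
    using le(1) that by (cases "rows s" rule: body_rows.cases) auto
  have ne2: "rows D \<noteq> k # Q" if "horiz D < k" for k Q
    using le(2) that by (cases "rows D") auto
  \<comment> \<open>Lengthening the upper row of a pair leaves the body unchanged and affects only
    \<open>hs_rows\<close>.\<close>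
  have sh: "body_rows (u # rows s) = body_rows (v # rows s)" "hs_rows (Suc (horiz s) # rows s) =
      (if odd (horiz s) then 1 else 0) + hs_rows (horiz s # rows s)"
      "hs_rows (Suc (Suc (horiz s)) # rows s) = 1 + hs_rows (horiz s # rows s)"
    if ne0: "rows s \<noteq> []" for u v
  proof -
    obtain b Q where R: "rows s = b # Q" using ne0 by (cases "rows s") auto
    then have "b div 2 \<le> horiz s div 2" using le(1) by (simp add: div_le_mono)
    moreover have "Suc (horiz s) div 2 = (if odd (horiz s) then 1 else 0) + horiz s div 2" by simp
    ultimately show "body_rows (u # rows s) =
        body_rows (v # rows s)" "hs_rows (Suc (horiz s) # rows s) =
        (if odd (horiz s) then 1 else 0) + hs_rows (horiz s # rows s)"
      "hs_rows (Suc (Suc (horiz s)) # rows s) = 1 + hs_rows (horiz s # rows s)" unfolding R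
          by (auto simp: Suc_diff_le)
  qed
  have nonempty: "rows s \<noteq> []" if "horiz s = Suc (horiz D)"
    using that lenr evr by auto
  consider (eq) "p = a" "q = a" | (start_o) "\<not> a" "\<not> W" "\<not> p" q | (start_b) "\<not>
      a" "\<not> W" p "\<not> q"
    | (end_o) a W "\<not> p" q | (end_b) a W p "\<not> q" | (zero) "p \<noteq> a \<or> q \<noteq>
        a" "\<not> (p \<noteq> q \<and> W = a)" by argo
  then show ?case
  proof cases
    case eq
    then have n: "horiz s = horiz D + of_bool W" using horiz unfolding l aa
        by (auto split: if_splits)
    have "odd (horiz s)" if W using n ev that by simp
    then show ?thesis using IH[of W] n eq nonempty sh ev unfolding l aa
      by (cases a; cases W) (auto simp: Let_def)
  next
    case start_o
    then have n: "horiz s = Suc (horiz D)" using horiz unfolding l aa by auto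
    then show ?thesis using IH[of True] start_o unfolding l aa by (simp add: Let_def)
  next
    case start_b
    then have n: "horiz s = Suc (horiz D)" using horiz unfolding l aa by auto
    then show ?thesis using IH[of True] start_b sh[OF nonempty[OF n]] ev unfolding l aa
        by (auto simp: Let_def)
  next
    case end_o
    then have n: "horiz s = horiz D" using horiz unfolding l aa by auto
    then show ?thesis using IH[of False] end_o ev unfolding l aa by (auto simp: Let_def)
  next
    case end_b
    then have n: "horiz s = horiz D" using horiz unfolding l aa by auto
    then show ?thesis using IH[of False] end_b ev unfolding l aa by (auto simp: Let_def)
  next
    case zero
    have "rows (a # a # D) \<noteq> body_rows (if W then horiz l # rows l else rows l)"
    proof (cases a)
      case a: True
      have "rows (a # a # D) = horiz D # horiz D # rows D" using a by simp
      moreover have "horiz s < horiz D" if "\<not> (\<not> W \<and> p \<and> q)"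
          using that zero horiz a unfolding l aa by (cases W; cases p; cases q) auto
      ultimately show ?thesis using zero a ne[THEN not_sym] ne1[THEN not_sym] unfolding l
          by (cases W; cases p; cases q) auto
    next
      case a: False
      then have "rows (a # a # D) = rows D" by simp
      moreover have "horiz D < horiz s \<and> (\<not> W \<longrightarrow> horiz s =
          Suc (Suc (horiz D))) \<and> (W \<and> p \<and> q \<longrightarrow> horiz s =
          Suc (Suc (Suc (horiz D)))) \<and> (W \<and> p \<noteq> q \<longrightarrow> horiz s =
          Suc (Suc (horiz D)))"
        using zero horiz a unfolding l aa by (cases W; cases p; cases q) auto
      ultimately show ?thesis using zero a ne2 ev unfolding l
          by (cases W; cases p; cases q) (auto elim!: evenE)
    qed
    moreover have "body_weight x W (a # a # D) l = 0" using zero unfolding l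
        by (cases a; cases W; cases p; cases q) auto
    ultimately show ?thesis unfolding aa by (auto simp: Let_def)
  qed
qed

lemma paired_of_rows: "body_rows (rows l) = rows l \<Longrightarrow>
    even (length (rows l)) \<Longrightarrow> even (horiz l) \<Longrightarrow> paired l"
proof (induction l rule: paired.induct)
  case (2 x) then show ?case by (cases x) auto
next
  case (3 x y s)
  have le: "\<forall>u\<in>set (rows s). u \<le> horiz s" using rows_le by auto
  show ?case
  proof (cases "rows s")
    case Nil
    then show ?thesis using 3 by (cases x; cases y) auto
  next
    case (Cons b R)
    then show ?thesis using 3 le odd_pos[of "horiz s"] by (cases x; cases y) auto
  qed
qed auto

section \<open>The body and the domino numbers as explicit counts\<close>

text \<open>The tested square is the bottom right one of the fourling around \<open>(r, c)\<close>;
  a shape contains a fourling iff it contains that square.\<close>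

definition blocks :: "square set \<Rightarrow> square set" where
  "blocks S = {(r, c). 1 \<le> r \<and> 1 \<le> c \<and> (2 * ((r + 1) div 2), 2 * ((c +
      1) div 2)) \<in> S}"

lemma blocks_mem:
  "(r, c) \<in> blocks S \<longleftrightarrow> 1 \<le> r \<and> 1 \<le> c \<and> (2 * ((r +
      1) div 2), 2 * ((c + 1) div 2)) \<in> S"
  by (simp add: blocks_def)

lemma fb_eq: assumes S: "is_shape S" shows "fb S = blocks S"
proof
  show "fb S \<subseteq> blocks S"
  proof clarify
    fix r c assume rc: "(r, c) \<in> fb S"
    then have "(2 * ((r + 1) div 2), 2 * ((c + 1) div 2)) \<in> fb S" "1 \<le> r \<and> 1 \<le> c"
      using fb_greatest(1)[OF S] shape_ge1[of "fb S"] unfolding fourling_shape_iff by blast+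
    then show "(r, c) \<in> blocks S" using fb_greatest(2)[OF S] unfolding blocks_def by blast
  qed
  have sub: "blocks S \<subseteq> S"
  proof clarify
    fix r c assume "(r, c) \<in> blocks S"
    then have "1 \<le> r" "1 \<le> c" "(2 * ((r + 1) div 2), 2 * ((c + 1) div 2)) \<in> S"
        by (auto simp: blocks_def)
    moreover have "r \<le> 2 * ((r + 1) div 2)" "c \<le> 2 * ((c + 1) div 2)" by presburger+
    ultimately show "(r, c) \<in> S" using shape_down[OF S] by blast
  qed
  have down: "(r', c') \<in> blocks S"
      if "(r, c) \<in> blocks S" "1 \<le> r'" "r' \<le> r" "1 \<le> c'" "c' \<le> c" for r c r' c'
  proof -
    have "(2 * ((r + 1) div 2), 2 * ((c + 1) div 2)) \<in> S" using that by (simp add: blocks_def)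
    moreover have "1 \<le> 2 * ((r' + 1) div 2)" "2 * ((r' + 1) div 2) \<le> 2 * ((r + 1) div 2)"
      "1 \<le> 2 * ((c' + 1) div 2)" "2 * ((c' + 1) div 2) \<le> 2 * ((c + 1) div 2)"
          using that by presburger+
    ultimately have "(2 * ((r' + 1) div 2), 2 * ((c' + 1) div 2)) \<in> S"
        using shape_down[OF S] by blast
    then show ?thesis using that by (simp add: blocks_def)
  qed
  have "1 \<le> r \<and> 1 \<le> c" if "(r, c) \<in> blocks S" for r c using that
      by (simp add: blocks_def)
  then have "is_shape (blocks S)"
    unfolding is_shape_iff using down finite_subset[OF sub shape_finite[OF S]] by blast
  moreover have "(2 * ((r + 1) div 2), 2 * ((c + 1) div 2)) \<in> blocks S"
      if "(r, c) \<in> blocks S" for r c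
  proof -
    have "2 * ((2 * k + 1) div 2) = 2 * k" for k :: nat by simp
    then show ?thesis using that by (auto simp: blocks_def)
  qed
  ultimately have "fourling_shape (blocks S)" unfolding fourling_shape_iff by blast
  then show "blocks S \<subseteq> fb S" using fb_greatest(3)[OF S] sub by blast
qed

lemma conjugate_shape: "is_shape S \<Longrightarrow> is_shape (conjugate S)"
proof -
  assume S: "is_shape S"
  have "conjugate S = prod.swap ` S" by (auto simp: conjugate_def)
  then have "finite (conjugate S)" using shape_finite[OF S] by simp
  then show ?thesis using shape_ge1[OF S] shape_down[OF S] unfolding is_shape_iff[of "conjugate S"]
    unfolding conjugate_def by blast
qed

text \<open>Each vertical domino has exactly one square in an even row, which bounds the number.
  Conversely a strip square in an even row shares its fourling with the square above, which is then
  in the strip too; these dominoes are disjoint.\<close>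

lemma vs_eq: assumes S: "is_shape S" shows "vs S = card {(r, c) \<in> strip S. even r}"
proof -
  let ?E = "{(r, c) \<in> strip S. even r}"
  let ?A = "{card F | F. (\<forall>d\<in>F. vertical_domino d \<and> d \<subseteq> strip S) \<and>
      pairwise disjnt F}"
  have "?E \<subseteq> S" unfolding strip_def by blast
  then have finE: "finite ?E" using shape_finite[OF S] finite_subset by blast
  have ub: "card F \<le> card ?E" if F: "\<forall>d\<in>F. vertical_domino d \<and>
      d \<subseteq> strip S" "pairwise disjnt F" for F
  proof -
    have "\<exists>e. e \<in> d \<and> e \<in> ?E" if dF: "d \<in> F" for d
    proof -
      have "vertical_domino d" "d \<subseteq> strip S" using F(1) dF by auto
      then obtain r c where d: "d = {(r, c), (Suc r, c)}" "d \<subseteq> strip S"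
          unfolding vertical_domino_def by blast
      show ?thesis
      proof (cases "even r")
        case True
        then have "(r, c) \<in> d \<and> (r, c) \<in> ?E" using d by simp
        then show ?thesis by blast
      next
        case False
        then have "(Suc r, c) \<in> d \<and> (Suc r, c) \<in> ?E" using d by simp
        then show ?thesis by blast
      qed
    qed
    then have "\<forall>d\<in>F. \<exists>e. e \<in> d \<and> e \<in> ?E" by blast
    from bchoice[OF this] obtain e where "\<forall>d\<in>F. e d \<in> d \<and> e d \<in> ?E"
        by (rule exE)
    then have e: "e d \<in> d \<and> e d \<in> ?E" if "d \<in> F" for d using that by (rule bspec)
    have "inj_on e F"
    proof (rule inj_onI)
      fix d d' assume "d \<in> F" "d' \<in> F" "e d = e d'"
      then have "e d \<in> d \<inter> d'" using e[of d] e[of d'] by auto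
      then show "d = d'" using F(2) \<open>d \<in> F\<close> \<open>d' \<in> F\<close>
          unfolding pairwise_def disjnt_def by blast
    qed
    moreover have "e ` F \<subseteq> ?E" using e by (intro image_subsetI) (rule conjunct2)
    ultimately show ?thesis by (rule card_inj_on_le[OF _ _ finE])
  qed
  have up: "(r, c) \<in> strip S" if "(Suc r, c) \<in> strip S" "odd r" for r c
  proof -
    have S': "(Suc r, c) \<in> S" "(Suc r, c) \<notin> blocks S" using that fb_eq[OF S]
        by (auto simp: strip_def)
    have e: "(Suc r + 1) div 2 = (r + 1) div 2" using that(2) by presburger
    have r: "1 \<le> r" using that(2) by presburger
    have c: "1 \<le> c" using shape_ge1[OF S S'(1)] by simp
    have "(r, c) \<in> S" using shape_down[OF S S'(1), of r c] r c by simp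
    moreover have "(r, c) \<notin> blocks S" using S'(2) c unfolding blocks_mem e by simp
    ultimately show ?thesis using fb_eq[OF S] by (simp add: strip_def)
  qed
  define F where "F = (\<lambda>(r, c). {(r - 1, c), (r, c)}) ` ?E"
  have pos: "r \<noteq> 0" if "(r, c) \<in> strip S" for r c using shape_ge1[OF S, of r c] that
      by (auto simp: strip_def)
  have "vertical_domino d \<and> d \<subseteq> strip S" if "d \<in> F" for d
  proof -
    obtain r c where rc: "d = {(r - 1, c), (r, c)}" "(r, c) \<in> strip S" "even r"
        using \<open>d \<in> F\<close> by (auto simp: F_def)
    then obtain k where k: "r = Suc k" using pos[of r c] by (cases r) auto
    then have "d = {(k, c), (Suc k, c)}" "(k, c) \<in> strip S" using rc up[of k c] by auto
    then show ?thesis using rc k unfolding vertical_domino_def by blast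
  qed
  moreover have "pairwise disjnt F"
  proof (rule pairwiseI)
    fix d d' assume "d \<in> F" "d' \<in> F" "d \<noteq> d'"
    then obtain r c r' c' where "d = {(r - 1, c), (r, c)}" "(r, c) \<in> strip S" "even r" "d' =
        {(r' - 1, c'), (r', c')}" "(r', c') \<in> strip S" "even r'"
      by (auto simp: F_def)
    moreover from this obtain k k' where "r = Suc k" "r' = Suc k'" using pos
        by (metis not0_implies_Suc)
    ultimately show "disjnt d d'" using \<open>d \<noteq> d'\<close> by (auto simp: disjnt_def)
  qed
  moreover have "card F = card ?E" unfolding F_def
  proof (rule card_image, rule inj_onI, clarify)
    fix r c r' c' assume "(r, c) \<in> strip S" "even r" "(r', c') \<in>
        strip S" "even r'" "{(r - 1, c), (r, c)} = {(r' - 1, c'), (r', c')}"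
    moreover from this obtain k k' where "r = Suc k" "r' = Suc k'" using pos
        by (metis not0_implies_Suc)
    ultimately show "r = r' \<and> c = c'" by (auto simp: doubleton_eq_iff)
  qed
  ultimately have "\<exists>F. card ?E =
      card F \<and> (\<forall>d\<in>F. vertical_domino d \<and> d \<subseteq> strip S) \<and>
      pairwise disjnt F"
    by (intro exI[of _ F]) simp
  then have "card ?E \<in> ?A" by (rule CollectI)
  moreover have "\<forall>k\<in>?A. k \<le> card ?E" using ub by blast
  moreover have "finite ?A" by (rule finite_subset[of _ "{..card ?E}"]) (use ub in auto)
  ultimately show ?thesis unfolding vs_def by (intro Max_eqI) blast+
qed

lemma hs_eq: assumes S: "is_shape S" shows "hs S = card {(r, c) \<in> strip S. even c}"
proof -
  have "blocks (conjugate S) = conjugate (blocks S)" by (auto simp: blocks_def conjugate_def)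
  then have "strip (conjugate S) = conjugate (strip S)"
    using fb_eq[OF S] fb_eq[OF conjugate_shape[OF S]] by (auto simp: strip_def conjugate_def)
  then have "{(r, c) \<in> strip (conjugate S). even r} =
      prod.swap ` {(r, c) \<in> strip S. even c}"
    by (auto simp: conjugate_def)
  then show ?thesis unfolding hs_def vs_eq[OF conjugate_shape[OF S]] by (simp add: card_image)
qed

lemma ferrers_two_mem:
  "(Suc (Suc i), c) \<in> ferrers (a # b # R) \<longleftrightarrow>
      (if i = 0 then 1 \<le> c \<and> c \<le> b else (i, c) \<in> ferrers R)"
  by (cases i) (simp_all add: ferrers_Cons_mem)

lemma blocks_ferrers: "even (length R) \<Longrightarrow> blocks (ferrers R) = ferrers (body_rows R)"
proof (induction R rule: body_rows.induct)
  case (1 a b R)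
  then have IH: "(r, c) \<in> blocks (ferrers R) \<longleftrightarrow>
      (r, c) \<in> ferrers (body_rows R)" for r c by simp
  have dv: "2 * ((c + 1) div 2) \<le> b \<longleftrightarrow>
      c \<le> 2 * (b div 2)" "1 \<le> c \<Longrightarrow> 1 \<le> 2 * ((c + 1) div 2)"
      for c by presburger+
  have two: "(2, y) \<in> ferrers (a' # b' # R') \<longleftrightarrow>
      1 \<le> y \<and> y \<le> b'" for y a' b' R'
    using ferrers_two_mem[of 0 y] by (simp add: numeral_2_eq_2)
  have "(r, c) \<in> blocks (ferrers (a # b # R)) \<longleftrightarrow>
      (r, c) \<in> ferrers (body_rows (a # b # R))" for r c
  proof (cases "r = 0 \<or> c = 0")
    case True
    then show ?thesis by (auto simp: blocks_def ferrers_def)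
  next
    case False
    then consider "r = Suc 0" | "r = Suc (Suc 0)" | k where "r = Suc (Suc (Suc k))"
      by (metis not0_implies_Suc)
    then show ?thesis
    proof cases
      case 1
      then show ?thesis using False dv[of c] by (simp add: blocks_mem two ferrers_Cons_mem)
    next
      case 2
      then show ?thesis using False dv[of c] by (simp add: blocks_mem two ferrers_two_mem)
    next
      case 3
      have e1: "2 * ((Suc (Suc (Suc k)) + 1) div 2) = Suc (Suc (2 * ((Suc k + 1) div 2)))" by simp
      have "(r, c) \<in> blocks (ferrers (a # b # R)) \<longleftrightarrow>
          (Suc k, c) \<in> blocks (ferrers R)"
        unfolding blocks_mem 3 e1 ferrers_two_mem by simp
      then show ?thesis using IH[of "Suc k" c] 3 by (simp add: ferrers_two_mem)
    qed
  qed
  then show ?case unfolding set_eq_iff split_paired_All by blast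
qed (auto simp: blocks_def)

lemma fb_ferrers:
  assumes "sorted_wrt (\<ge>) R" "even (length R)"
  shows "fb (ferrers R) = ferrers (body_rows R)"
  using fb_eq[OF ferrers_shape[OF assms(1)]] blocks_ferrers[OF assms(2)] by simp

text \<open>Deleting two rows respects the grid of fourlings, so counts by a parity condition
  \<open>P\<close> split off one pair of rows.\<close>

lemma card_strip_two:
  assumes P: "\<And>r c. P (Suc (Suc r), c) \<longleftrightarrow> P (r, c)" and ba: "b \<le> a"
  shows "card {x \<in> ferrers (a # b # R) - ferrers (body_rows (a # b # R)). P x} =
    card {c. 2 * (b div 2) < c \<and> c \<le> a \<and> P (1, c)} +
        card {c. 2 * (b div 2) < c \<and> c \<le> b \<and> P (2, c)} +
    card {x \<in> ferrers R - ferrers (body_rows R). P x}"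
proof -
  let ?A = "{c. 2 * (b div 2) < c \<and> c \<le> a \<and> P (1, c)}" and ?B =
      "{c. 2 * (b div 2) < c \<and> c \<le> b \<and> P (2, c)}"
  let ?C = "{x \<in> ferrers R - ferrers (body_rows R). P x}"
  let ?d = "\<lambda>x :: square. (Suc (Suc (fst x)), snd x)"
  have inj: "inj ?d" by (auto simp: inj_on_def prod_eq_iff)
  have mem: "(Suc (Suc r), c) \<in> ?d ` X \<longleftrightarrow>
      (r, c) \<in> X" "(0, c) \<notin> ?d ` X" "(Suc 0, c) \<notin> ?d ` X" for r c X
    by (auto simp: image_iff Bex_def)
  have "(r, c) \<in> {x \<in> ferrers (a # b # R) - ferrers (body_rows (a # b # R)).
      P x} \<longleftrightarrow> (r, c) \<in> Pair 1 ` ?A \<union> Pair 2 ` ?B \<union>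
      ?d ` ?C" for r c
  proof -
    consider "r = 0" | "r = Suc 0" | "r = Suc (Suc 0)" | k where "r = Suc (Suc (Suc k))"
      by (metis not0_implies_Suc)
    then show ?thesis
    proof cases
      case 1
      then show ?thesis by (auto simp: ferrers_Cons_mem mem)
    next
      case 2
      then show ?thesis by (auto simp: ferrers_Cons_mem mem)
    next
      case 3
      have "(0, c) \<notin> ?C" by (simp add: ferrers_Cons_mem)
      then show ?thesis using 3 P[of 0 c] by (auto simp: ferrers_two_mem mem numeral_2_eq_2)
    next
      case 4
      then show ?thesis using P[of "Suc k" c] by (auto simp: ferrers_two_mem mem numeral_2_eq_2)
    qed
  qed
  then have eq: "{x \<in> ferrers (a # b # R) - ferrers (body_rows (a # b # R)). P x} =
      Pair 1 ` ?A \<union> Pair 2 ` ?B \<union> ?d ` ?C"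
    unfolding set_eq_iff split_paired_All by blast
  have fin: "finite ?A" "finite ?B" "finite ?C" using ferrers_finite[of R]
      by (auto intro: finite_subset[of _ "{..a}"] finite_subset[of _ "{..b}"])
  have d1: "Pair (1::nat) ` ?A \<inter> Pair 2 ` ?B = {}" by auto
  have d2: "(Pair 1 ` ?A \<union> Pair 2 ` ?B) \<inter> ?d ` ?C = {}"
  proof -
    have "(1, c) \<notin> ?d ` ?C" "(2, c) \<notin> ?d ` ?C" for c
      using mem(3)[of c ?C] mem(1)[of 0 c ?C] by (simp_all add: numeral_2_eq_2 ferrers_Cons_mem(1))
    then show ?thesis by blast
  qed
  have "card (Pair (1::nat) ` ?A \<union> Pair 2 ` ?B \<union> ?d ` ?C) =
      card (Pair (1::nat) ` ?A) + card (Pair (2::nat) ` ?B) + card (?d ` ?C)"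
    using fin d1 d2 by (subst card_Un_disjoint) (simp_all add: card_Un_disjoint)
  moreover have "card (Pair (i::nat) ` B) = card B" for i and B :: "nat set"
      by (simp add: card_image inj_on_def)
  moreover have "card (?d ` ?C) = card ?C"
      by (rule card_image) (rule inj_on_subset[OF inj subset_UNIV])
  ultimately show ?thesis unfolding eq by (simp only:)
qed

lemma card_even_interval: "card {c. 2 * k < c \<and> c \<le> a \<and> even c} = a div 2 - k"
proof -
  have "{c. 2 * k < c \<and> c \<le> a \<and> even c} = (\<lambda>i. 2 * i) ` {k<..a div 2}"
  proof (intro equalityI subsetI)
    fix c assume c: "c \<in> {c. 2 * k < c \<and> c \<le> a \<and> even c}"
    then have "c = 2 * (c div 2)" by simp
    moreover have "c div 2 \<in> {k<..a div 2}" using c by (simp add: div_le_mono) presburger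
    ultimately show "c \<in> (\<lambda>i. 2 * i) ` {k<..a div 2}" by (rule image_eqI)
  next
    fix c assume "c \<in> (\<lambda>i. 2 * i) ` {k<..a div 2}"
    then obtain i where "c = 2 * i" "k < i" "i \<le> a div 2" by auto
    then show "c \<in> {c. 2 * k < c \<and> c \<le> a \<and> even c}" by simp
  qed
  moreover have "inj_on (\<lambda>i. 2 * i) {k<..a div 2}" by (simp add: inj_on_def)
  ultimately show ?thesis by (simp only: card_image card_greaterThanAtMost)
qed

lemma card_strip_even_row:
  assumes "sorted_wrt (\<ge>) R" "even (length R)"
  shows "card {x \<in> ferrers R - ferrers (body_rows R). even (fst x)} = vs_rows R"
  using assms
proof (induction R rule: body_rows.induct)
  case (1 a b R)
  have "{c. 2 * (b div 2) < c \<and> c \<le> b \<and> even (fst (2::nat, c))} =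
      {2 * (b div 2)<..b}" by auto
  then have "card {c. 2 * (b div 2) < c \<and> c \<le> b \<and> even (fst (2::nat, c))} = b mod 2"
    by (simp add: minus_mult_div_eq_mod)
  then show ?case using 1 by (subst card_strip_two) auto
qed auto

lemma card_strip_even_column:
  assumes "sorted_wrt (\<ge>) R" "even (length R)"
  shows "card {x \<in> ferrers R - ferrers (body_rows R). even (snd x)} = hs_rows R"
  using assms
proof (induction R rule: body_rows.induct)
  case (1 a b R)
  then show ?case by (subst card_strip_two) (auto simp: card_even_interval)
qed auto

lemma vs_ferrers:
  assumes "sorted_wrt (\<ge>) R" "even (length R)"
  shows "vs (ferrers R) = vs_rows R"
proof -
  have "{(r, c) \<in> strip (ferrers R). even r} =
      {x \<in> ferrers R - ferrers (body_rows R). even (fst x)}"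
    using fb_ferrers[OF assms] by (auto simp: strip_def)
  then show ?thesis using vs_eq[OF ferrers_shape[OF assms(1)]] card_strip_even_row[OF assms] by simp
qed

lemma hs_ferrers:
  assumes "sorted_wrt (\<ge>) R" "even (length R)"
  shows "hs (ferrers R) = hs_rows R"
proof -
  have "{(r, c) \<in> strip (ferrers R). even c} =
      {x \<in> ferrers R - ferrers (body_rows R). even (snd x)}"
    using fb_ferrers[OF assms] by (auto simp: strip_def)
  then show ?thesis using hs_eq[OF ferrers_shape[OF assms(1)]] card_strip_even_column[OF assms] by
      simp
qed

section \<open>Extraction of coefficients and conclusion\<close>

lemma hs_coefficient:
  assumes N: "even N" "n < N" and D: "paired D" "length D = 2 * N" "horiz D = N" "area D > 0"
  shows "(\<Sum>l | length l = 2 * N \<and> horiz l = N \<and> rows D =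
      body_rows (rows l) \<and> hs_rows (rows l) = k. imbalance N n l) = 0"
proof -
  define W0 where "W0 = {l. length l = 2 * N \<and> horiz l = N \<and> rows D = body_rows (rows l)}"
  have finL: "finite {l :: bool list. length l = 2 * N}"
    using finite_lists_length_eq[of "UNIV :: bool set" "2 * N"] by simp
  then have fin: "finite W0" by (rule rev_finite_subset) (auto simp: W0_def)
  \<comment> \<open>Inserting \<open>k\<close> keeps it within the degree bound even if no word
    attains it.\<close>
  define K where "K = Max (insert k ((\<lambda>l. hs_rows (rows l)) ` W0))"
  define c where "c j = (\<Sum>l | l \<in> W0 \<and> hs_rows (rows l) = j. imbalance N n l)" for j
  have K: "k \<le> K" "hs_rows (rows l) \<le> K" if "l \<in> W0" for l using fin that
      by (auto simp: K_def)
  have kK: "k \<le> K" using fin by (auto simp: K_def)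
  have root: "(\<Sum>j\<le>K. c j * (- (X * X)) ^ j) = 0" if X: "X > 1" for X :: real
  proof -
    have "0 = (\<Sum>l | length l = 2 * N. body_weight (- (X * X)) False D l * imbalance N n l)"
      using body_weight_imbalance[OF N D(1,2,4) X] by (simp add: word_sum_eq_sum)
    also have "\<dots> = (\<Sum>l\<in>W0. body_weight (- (X * X)) False D l * imbalance N n l)"
    proof (rule sum.mono_neutral_right[OF finL], force simp: W0_def, rule ballI)
      fix l assume l: "l \<in> {l. length l = 2 * N} - W0"
      show "body_weight (- (X * X)) False D l * imbalance N n l = 0"
      proof (cases "imbalance N n l = 0")
        case False
        then have "horiz l = N" using imbalance_nz by blast
        then show ?thesis using body_weight_rows[OF D(1), of l False] l D by (auto simp: W0_def)
      qed simp
    qed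
    also have "\<dots> = (\<Sum>l\<in>W0. imbalance N n l * (- (X * X)) ^ hs_rows (rows l))"
    proof (rule sum.cong)
      fix l assume "l \<in> W0"
      then show "body_weight (- (X * X)) False D l * imbalance N n l =
          imbalance N n l * (- (X * X)) ^ hs_rows (rows l)"
        using body_weight_rows[OF D(1), of l False] D by (simp add: W0_def)
    qed simp
    also have "\<dots> = (\<Sum>j\<le>K. \<Sum>l | l \<in> W0 \<and> hs_rows (rows l) =
        j. imbalance N n l * (- (X * X)) ^ hs_rows (rows l))"
      by (rule sum.group[symmetric, OF fin]) (use K in auto)
    also have "\<dots> = (\<Sum>j\<le>K. c j * (- (X * X)) ^ j)"
      by (rule sum.cong) (auto simp: c_def sum_distrib_right)
    finally show ?thesis by simp
  qed
  \<comment> \<open>The substitution \<open>- (X * X)\<close> is injective on \<open>X > 1\<close>,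
    so the polynomial has infinitely many roots.\<close>
  have "infinite ((\<lambda>X :: real. - (X * X)) ` {1<..})"
  proof (subst finite_image_iff)
    show "inj_on (\<lambda>X :: real. - (X * X)) {1<..}"
    proof (rule inj_onI)
      fix x y :: real assume "x \<in> {1<..}" "y \<in> {1<..}" "- (x * x) = - (y * y)"
      then show "x = y" using power2_eq_imp_eq[of x y] by (simp add: power2_eq_square)
    qed
  qed (simp add: infinite_Ioi)
  then have "infinite {y. (\<Sum>j\<le>K. c j * y ^ j) = 0}"
    by (rule contrapos_nn) (rule finite_subset, use root in auto)
  then have "c k = 0" using polyfun_finite_roots[of c K] kK by blast
  moreover have "{l. l \<in> W0 \<and> hs_rows (rows l) = k} = {l. length l =
      2 * N \<and> horiz l = N \<and> rows D = body_rows (rows l) \<and> hs_rows (rows l) = k}"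
    by (auto simp: W0_def)
  ultimately show ?thesis by (simp add: c_def)
qed

theorem theorem3p3:
  fixes D :: "square set" and h v s :: nat
  assumes "fourling_shape D" and "D \<noteq> {}"
  shows "(\<Sum>S | is_shape S \<and> fb S = D \<and> card (strip S) = s \<and> hs S =
      h \<and> vs S = v.
            sign_imbalance S) = 0"
proof -
  define n where "n = card D + s"
  \<comment> \<open>Even, so that the main diagonal is white, and larger than \<open>n\<close>, so
    that no shape of size \<open>n\<close> reaches the sides of the box.\<close>
  define N where "N = 2 * (n + 1)"
  have N: "even N" "n < N" by (simp_all add: N_def)
  have shD: "is_shape D" using assms(1) by (simp add: fourling_shape_def)
  have finD: "finite D" by (rule shape_finite[OF shD])
  obtain d where d: "length d = 2 * N" "horiz d = N" "ferrers (rows d) = D"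
    using shape_rows[OF shD, of N] by (auto simp: N_def n_def)
  have even_rows: "even (length (rows l))" if "length l = 2 * N" "horiz l = N" for l
    using length_rows[of l] that N by simp
  have fbl: "fb (ferrers (rows l)) = ferrers (body_rows (rows l))" "vs (ferrers (rows l)) =
      vs_rows (rows l)" "hs (ferrers (rows l)) = hs_rows (rows l)"
    if "length l = 2 * N" "horiz l = N" for l
    using even_rows[OF that] by (simp_all add: fb_ferrers vs_ferrers hs_ferrers rows_sorted)
  have "fb D = D" using fb_greatest(2)[OF shD] fb_greatest(3)[OF shD assms(1)] by blast
  then have "body_rows (rows d) = rows d" using fbl(1)[OF d(1,2)] d(3) by (intro ferrers_inj) auto
  then have paired: "paired d" using even_rows[OF d(1,2)] N d by (intro paired_of_rows) auto
  have area: "area d = card D" using ferrers_card[of "rows d"] d by (simp add: sum_rows)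
  then have pos: "area d > 0" using finD assms(2) by (simp add: card_gt_0_iff)
  let ?sh = "\<lambda>l. ferrers (rows l)"
  define W where "W = {l. length l = 2 * N \<and> horiz l = N \<and> area l = n}"
  define Z where "Z = {l \<in> W. rows d = body_rows (rows l) \<and> hs_rows (rows l) =
      h \<and> vs_rows (rows l) = v}"
  have bij: "inj_on ?sh W" "?sh ` W = {S. is_shape S \<and> card S = n}"
    unfolding W_def using bij_words_shapes[OF N(2)]
        by (rule bij_betw_imp_inj_on, rule bij_betw_imp_surj_on)
  have fbD: "fb (?sh l) = D \<longleftrightarrow> rows d = body_rows (rows l)" if "l \<in> W" for l
  proof -
    have "length (rows d) = length (body_rows (rows l))"
        using length_rows[of l] length_rows[of d] that d by (simp add: W_def)
    then have "ferrers (rows d) = ferrers (body_rows (rows l)) \<longleftrightarrow>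
        rows d = body_rows (rows l)" 
      using ferrers_inj[of "rows d" "body_rows (rows l)"] by auto
    moreover have "fb (?sh l) = ferrers (body_rows (rows l))" using fbl(1)[of l] that
        by (simp add: W_def)
    ultimately show ?thesis unfolding d(3) by metis
  qed
  have card_shape: "card S = card (fb S) + card (strip S)" if "is_shape S" for S
  proof -
    have "finite (fb S)" using fb_greatest(2)[OF that] shape_finite[OF that] finite_subset by blast
    then show ?thesis using fb_greatest(2)[OF that] shape_finite[OF that]
      by (simp add: strip_def card_Diff_subset card_mono)
  qed
  have "{S. is_shape S \<and> fb S = D \<and> card (strip S) = s \<and> hs S = h \<and> vs S =
      v} = ?sh ` Z"
  proof (intro equalityI subsetI)
    fix S assume S: "S \<in> {S. is_shape S \<and> fb S = D \<and> card (strip S) =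
        s \<and> hs S = h \<and> vs S = v}"
    then have "card S = n" using card_shape[of S] by (simp add: n_def)
    then have "S \<in> ?sh ` W" using S unfolding bij(2) by simp
    then obtain l where l: "l \<in> W" "S = ?sh l" by blast
    then have "l \<in> Z" using S fbD[OF l(1)] fbl[of l] by (simp add: Z_def W_def)
    then show "S \<in> ?sh ` Z" using l by blast
  next
    fix S assume "S \<in> ?sh ` Z"
    then obtain l where l: "l \<in> Z" "S = ?sh l" by blast
    then have lW: "l \<in> W" by (simp add: Z_def)
    then have "S \<in> ?sh ` W" using l by blast
    then have S: "is_shape S" "card S = n" unfolding bij(2) by auto
    moreover have "fb S = D" using l fbD[OF lW] by (simp add: Z_def)
    ultimately show "S \<in> {S. is_shape S \<and> fb S = D \<and> card (strip S) =
        s \<and> hs S = h \<and> vs S = v}"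
      using l lW fbl[of l] card_shape[of S] by (simp add: Z_def W_def n_def)
  qed
  moreover have "inj_on ?sh Z" by (rule inj_on_subset[OF bij(1)]) (auto simp: Z_def)
  ultimately have "real_of_int (\<Sum>S | is_shape S \<and> fb S = D \<and> card (strip S) =
      s \<and> hs S = h \<and> vs S = v. sign_imbalance S) =
    (\<Sum>l\<in>Z. real_of_int (sign_imbalance (?sh l)))" by (simp add: sum.reindex)
  also have "\<dots> = (\<Sum>l\<in>Z. imbalance N n l)"
    by (rule sum.cong) (auto simp: Z_def W_def sign_imbalance_word)
  also have "\<dots> = 0"
  proof -
    \<comment> \<open>Where the imbalance is nonzero, the colour excess is the parity of
      \<open>n\<close>; together with the size of the strip it determines
      \<open>hs + vs\<close>.\<close>
    have hv: "hs_rows (rows l) + vs_rows (rows l) = s div 2" if l: "length l = 2 * N" "horiz l =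
        N" "rows d = body_rows (rows l)" and nz: "imbalance N n l \<noteq> 0" for l
    proof -
      have "area l = n" using imbalance_nz[OF nz] by simp
      then have "int n = int (card D) + 2 * int (hs_rows (rows l) + vs_rows (rows l)) +
          row_balance (rows l)"
        using rows_balance[OF rows_sorted even_rows[OF l(1,2)]] l(3) area sum_rows[of l]
            sum_rows[of d] by simp
      moreover have "balance l = 2 * row_balance (rows l)" using balance_rows[of l] l N by simp
      moreover have "balance l = 2 * of_bool (odd n)"
          using imbalance_chess[OF N(1), of n] nz by blast
      ultimately have "int s = 2 * int (hs_rows (rows l) + vs_rows (rows l)) + of_bool (odd n)"
          by (simp add: n_def)
      then have "s = 2 * (hs_rows (rows l) + vs_rows (rows l)) + of_bool (odd n)"
          by (cases "odd n") auto
      then show ?thesis by (cases "odd n") simp_all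
    qed
    show ?thesis
    \<comment> \<open>In the first case, words of \<open>?V\<close> outside \<open>Z\<close> have
      zero imbalance: a nonzero one forces size \<open>n\<close> and \<open>vs = v\<close>. In the
      second case every term is zero.\<close>
    proof (cases "h + v = s div 2")
      case True
      let ?V = "{l. length l = 2 * N \<and> horiz l = N \<and> rows d =
          body_rows (rows l) \<and> hs_rows (rows l) = h}"
      have "finite {l :: bool list. length l = 2 * N}"
        using finite_lists_length_eq[of "UNIV :: bool set" "2 * N"] by simp
      then have fin: "finite ?V" by (rule rev_finite_subset) auto
      have "(\<Sum>l\<in>Z. imbalance N n l) = (\<Sum>l\<in>?V. imbalance N n l)"
      proof (rule sum.mono_neutral_left[OF fin])
        show "Z \<subseteq> ?V" by (auto simp: Z_def W_def)
        show "\<forall>l\<in>?V - Z. imbalance N n l = 0"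
        proof (rule ballI, rule ccontr)
          fix l assume l: "l \<in> ?V - Z" and nz: "imbalance N n l \<noteq> 0"
          from l have "hs_rows (rows l) + vs_rows (rows l) = s div 2" "hs_rows (rows l) = h"
              using hv[OF _ _ _ nz] by simp_all
          then have "vs_rows (rows l) = v" using True by simp
          then show False using l imbalance_nz[OF nz] by (simp add: Z_def W_def) blast
        qed
      qed
      then show ?thesis using hs_coefficient[OF N paired d(1,2) pos] by simp
    next
      case False
      show ?thesis
      proof (rule sum.neutral, rule ballI, rule ccontr)
        fix l assume "l \<in> Z" "imbalance N n l \<noteq> 0"
        then show False using hv[of l] False by (simp add: Z_def W_def)
      qed
    qed
  qed
  finally show ?thesis by (simp only: of_int_eq_0_iff)
qed

end
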